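(* Let $L>0$, $T>0$, $W^0\in\widehat H^0(\mathbb R^2)$, $W^T\in\widehat H^0(\mathbb R^2)$, and put $W_0^T=W^T-\mathcal W_0(\cdot,T)$. Suppose that $W_0^T\in\mathcal H$ and that $$|W_0^T(x)|\le\frac L{2\pi}e^{-\frac{|x|^2}{4T}}\ln\left(1+\frac{4T}{|x|^2}\right),\quad x\in\mathbb R^2\setminus\{0\}.$$ Let $$\omega_n=-2\frac{n!}{(2n)!}\int_0^\infty\int_0^\infty x_1^{2n}W_0^T(x_1,x_2)\,dx_1\,dx_2,\quad n=0,1,2,\dots.$$ If for each $N\in\mathbb N$ there exists $u_N\in L^\infty(0,T)$ with $\|u_N\|_{L^\infty(0,T)}\le L$ such that $$\int_0^T\xi^nu_N(T-\xi)\,d\xi=\omega_n,\quad n=0,1,\dots,N,$$ then $W^T\in\overline{\mathcal R_T^L(W^0)}$, where the closure is taken in $\widehat H^0(\mathbb R^2)$.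
   Context: $\mathbb R_+=(0,+\infty)$; function spaces are complex; pointwise bounds on $L^2$ functions are understood a.e. $\widehat H^0(\mathbb R^2)$ is the subspace of $L^2(\mathbb R^2)$ (with the $L^2$ norm) of functions even with respect to $x_1$. $\mathcal H=\{f\in L^2(\mathbb R^2): \exists g\in L^2(\mathbb R_+),\ f(x)=g(|x|^2)\text{ a.e. on }\mathbb R^2\}$. For $W^0\in\widehat H^0(\mathbb R^2)$ and $u\in L^\infty(0,T)$ put $$\mathcal W_0(\cdot,T)=\frac1{4\pi T}e^{-\frac{|\cdot|^2}{4T}}*W^0,\qquad \mathcal W_u(x,T)=-\frac1\pi\int_0^T\frac1{2\xi}e^{-\frac{|x|^2}{4\xi}}u(T-\xi)\,d\xi .$$ Then $W(\cdot,T)=\mathcal W_0(\cdot,T)+\mathcal W_u(\cdot,T)$ is the state at time $T$ of the unique solution of the control system $W_t=\Delta W-2\delta u(t)$, $W(\cdot,0)=W^0$ on $\mathbb R^2$. Let $$\mathcal R_T^L(W^0)=\{V\in\widehat H^0(\mathbb R^2):\exists u\in L^\infty(0,T),\ \|u\|_{L^\infty(0,T)}\le L,\ V=\mathcal W_0(\cdot,T)+\mathcal W_u(\cdot,T)\}.$$ *)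

theory Defs
  imports "HOL-Analysis.Analysis" "HOL-Probability.Essential_Supremum"
begin

text \<open>
  The plane is modelled by \<^typ>\<open>real \<times> real\<close>, whose norm is the Euclidean one. Elements of the
  Lebesgue spaces are represented by complex-valued Lebesgue measurable functions; equality
  of such elements is stated as equality almost everywhere.
\<close>

definition L2_space :: "'a::euclidean_space set \<Rightarrow> ('a \<Rightarrow> complex) set" where
  "L2_space S = {f \<in> borel_measurable (lebesgue_on S).
     integrable (lebesgue_on S) (\<lambda>x. (cmod (f x))\<^sup>2)}"

definition L2_norm :: "(real \<times> real \<Rightarrow> complex) \<Rightarrow> real" where
  "L2_norm f = sqrt (LINT x|lebesgue. (cmod (f x))\<^sup>2)"

definition Linf_norm :: "real \<Rightarrow> (real \<Rightarrow> complex) \<Rightarrow> ereal" where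
  "Linf_norm T u = esssup (lebesgue_on {0<..<T}) (\<lambda>t. ereal (cmod (u t)))"

definition Linf_space :: "real \<Rightarrow> (real \<Rightarrow> complex) set" where
  "Linf_space T = {u \<in> borel_measurable (lebesgue_on {0<..<T}). Linf_norm T u < \<infinity>}"

definition Hhat0 :: "(real \<times> real \<Rightarrow> complex) set" where
  "Hhat0 = {f \<in> L2_space UNIV. AE x in lebesgue. f (- fst x, snd x) = f x}"

text \<open>
  The topology of the \<open>L2\<close> (semi)norm on representatives. Open sets are saturated with respect
  to equality almost everywhere, so closures correspond to closures in the normed space of
  equivalence classes.
\<close>

definition Hhat0_topology :: "(real \<times> real \<Rightarrow> complex) topology" where
  "Hhat0_topology = topology (\<lambda>U. U \<subseteq> Hhat0 \<and>
     (\<forall>f\<in>U. \<exists>\<epsilon>>0. \<forall>g\<in>Hhat0. L2_norm (\<lambda>x. g x - f x) < \<epsilon> \<longrightarrow> g \<in> U))"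

lemma openin_Hhat0_topology:
  "openin Hhat0_topology U \<longleftrightarrow> U \<subseteq> Hhat0 \<and>
     (\<forall>f\<in>U. \<exists>\<epsilon>>0. \<forall>g\<in>Hhat0. L2_norm (\<lambda>x. g x - f x) < \<epsilon> \<longrightarrow> g \<in> U)"
proof -
  let ?P = "\<lambda>U. U \<subseteq> Hhat0 \<and>
     (\<forall>f\<in>U. \<exists>\<epsilon>>0. \<forall>g\<in>Hhat0. L2_norm (\<lambda>x. g x - f x) < \<epsilon> \<longrightarrow> g \<in> U)"
  have "?P (S \<inter> U)" if S: "?P S" and U: "?P U" for S U
  proof (intro conjI ballI)
    show "S \<inter> U \<subseteq> Hhat0" using S by blast
    fix f assume "f \<in> S \<inter> U"
    then obtain a b where a: "a > 0" "\<forall>g\<in>Hhat0. L2_norm (\<lambda>x. g x - f x) < a \<longrightarrow> g \<in> S"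
      and b: "b > 0" "\<forall>g\<in>Hhat0. L2_norm (\<lambda>x. g x - f x) < b \<longrightarrow> g \<in> U"
      using S U by (metis IntD1 IntD2)
    then show "\<exists>\<epsilon>>0. \<forall>g\<in>Hhat0. L2_norm (\<lambda>x. g x - f x) < \<epsilon> \<longrightarrow> g \<in> S \<inter> U"
      by (intro exI[of _ "min a b"]) auto
  qed
  moreover have "?P (\<Union>K)" if "\<forall>S\<in>K. ?P S" for K
    using that by (meson Union_iff Union_least)
  ultimately have "istopology ?P"
    unfolding istopology_def by blast
  then show ?thesis
    by (simp add: Hhat0_topology_def topology_inverse')
qed

lemma topspace_Hhat0_topology: "topspace Hhat0_topology = Hhat0"
proof -
  have "openin Hhat0_topology Hhat0"
    unfolding openin_Hhat0_topology by (auto intro: exI[of _ 1])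
  then show ?thesis
    by (metis openin_Hhat0_topology openin_subset openin_topspace subset_antisym)
qed

text \<open>Values of \<open>g\<close> outside \<open>(0, \<infinity>)\<close> are irrelevant, since the origin is a null set.\<close>

definition radial_L2 :: "(real \<times> real \<Rightarrow> complex) set" where
  "radial_L2 = {f \<in> L2_space UNIV.
     \<exists>g\<in>L2_space {0<..}. AE x in lebesgue. f x = g ((norm x)\<^sup>2)}"

definition free_state :: "(real \<times> real \<Rightarrow> complex) \<Rightarrow> real \<Rightarrow> real \<times> real \<Rightarrow> complex" where
  "free_state W0 T x =
     (LINT y|lebesgue. (1 / (4 * pi * T) * exp (- (norm (x - y))\<^sup>2 / (4 * T))) *\<^sub>R W0 y)"

definition control_state :: "(real \<Rightarrow> complex) \<Rightarrow> real \<Rightarrow> real \<times> real \<Rightarrow> complex" where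
  "control_state u T x = - (1 / pi) *\<^sub>R
     (LINT \<xi>:{0<..<T}|lebesgue. (1 / (2 * \<xi>) * exp (- (norm x)\<^sup>2 / (4 * \<xi>))) *\<^sub>R u (T - \<xi>))"

definition reachable_set ::
  "real \<Rightarrow> real \<Rightarrow> (real \<times> real \<Rightarrow> complex) \<Rightarrow> (real \<times> real \<Rightarrow> complex) set" where
  "reachable_set L T W0 = {V \<in> Hhat0.
     \<exists>u\<in>Linf_space T. Linf_norm T u \<le> ereal L \<and>
       (AE x in lebesgue. V x = free_state W0 T x + control_state u T x)}"

end

theory Submission
  imports Defs "HOL-Probability.Sinc_Integral"
begin

text \<open>
  Both the target \<open>W0T\<close> and the states produced by controls are radial, so they are functions \<open>G\<close>
  and \<open>H\<^sub>N\<close> of \<open>s = |x|\<^sup>2\<close>, where \<open>H\<^sub>N\<close> belongs to the control \<open>u\<^sub>N\<close>. The hypothesis on the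
  \<open>\<omega> n\<close> says that \<open>D\<^sub>N = G - H\<^sub>N\<close> has vanishing moments up to order \<open>N\<close>. As \<open>|D\<^sub>N|\<close> is dominated
  by a fixed exponentially decaying weight, polynomials are dense in the weighted \<open>L1\<close> space, and
  therefore \<open>D\<^sub>N\<close> tends weakly to \<open>0\<close>.

  Strong convergence follows without any compactness argument from
  \<open>\<parallel>D\<^sub>N\<parallel>\<^sup>2 = \<langle>D\<^sub>N, G\<rangle> - \<langle>D\<^sub>N, H\<^sub>N\<rangle>\<close>. The first term vanishes by weak convergence. In the second
  one the bounded control is moved out of the integral operator: it is at most \<open>L\<close> times the
  \<open>L1\<close> norm over \<open>\<xi> \<in> (0, T)\<close> of \<open>\<langle>D\<^sub>N, k(\<cdot>, \<xi>)\<rangle>\<close>, with \<open>k\<close> the heat kernel, which tends to \<open>0\<close>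
  by weak convergence for each \<open>\<xi>\<close> and dominated convergence in \<open>\<xi>\<close>.
\<close>

section \<open>Weak convergence from vanishing moments\<close>

text \<open>The majorant holds at every point rather than almost everywhere, so estimates stay
  pointwise. The natural test functions are then those that are integrable against the weight
  \<open>B\<close>.\<close>

locale dominated_sequence =
  fixes D :: "nat \<Rightarrow> real \<Rightarrow> complex" and B :: "real \<Rightarrow> real"
  assumes D_measurable [measurable]: "\<And>N. D N \<in> borel_measurable borel"
    and B_measurable [measurable]: "B \<in> borel_measurable borel"
    and D_le: "\<And>N s. cmod (D N s) \<le> B s"
begin

lemma B_nonneg: "0 \<le> B s"
  using D_le[of 0 s] norm_ge_zero order_trans by blast

text \<open>Measurability and weighted integrability belong to the predicate because the Bochner
  integral of a nonintegrable function is 0; with them the limit concerns genuine integrals. The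
  pairing is bilinear, without conjugation.\<close>

definition weakly_null :: "(real \<Rightarrow> complex) \<Rightarrow> bool" where
  "weakly_null \<phi> \<longleftrightarrow> \<phi> \<in> borel_measurable borel \<and> integrable lborel (\<lambda>s. B s * cmod (\<phi> s)) \<and>
     (\<lambda>N. LINT s|lborel. D N s * \<phi> s) \<longlonglongrightarrow> 0"

lemma weakly_nullI:
  assumes "\<phi> \<in> borel_measurable borel" "integrable lborel (\<lambda>s. B s * cmod (\<phi> s))"
    "(\<lambda>N. LINT s|lborel. D N s * \<phi> s) \<longlonglongrightarrow> 0"
  shows "weakly_null \<phi>"
  using assms by (simp add: weakly_null_def)

lemma weakly_null_measurable: "weakly_null \<phi> \<Longrightarrow> \<phi> \<in> borel_measurable borel"
  by (simp add: weakly_null_def)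

lemma integrable_D_mult:
  assumes "\<phi> \<in> borel_measurable borel" "integrable lborel (\<lambda>s. B s * cmod (\<phi> s))"
  shows "integrable lborel (\<lambda>s. D N s * \<phi> s)"
  by (rule Bochner_Integration.integrable_bound[OF assms(2)])
     (use assms(1) B_nonneg D_le in \<open>auto simp: norm_mult intro!: mult_right_mono\<close>)

lemma weakly_null_add:
  assumes "weakly_null \<phi>" "weakly_null \<psi>"
  shows "weakly_null (\<lambda>s. \<phi> s + \<psi> s)"
proof (rule weakly_nullI)
  note [measurable] = assms[THEN weakly_null_measurable]
  have "integrable lborel (\<lambda>s. B s * cmod (\<phi> s) + B s * cmod (\<psi> s))"
    using assms by (auto simp: weakly_null_def)
  then show "integrable lborel (\<lambda>s. B s * cmod (\<phi> s + \<psi> s))"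
    by (rule Bochner_Integration.integrable_bound)
      (auto simp: abs_mult B_nonneg simp flip: distrib_left intro!: mult_left_mono norm_triangle_ineq
        order_trans[OF norm_triangle_ineq])
  have "(\<lambda>N. (LINT s|lborel. D N s * \<phi> s) + (LINT s|lborel. D N s * \<psi> s)) \<longlonglongrightarrow> 0 + 0"
    using assms by (intro tendsto_add) (auto simp: weakly_null_def)
  also have "(\<lambda>N. (LINT s|lborel. D N s * \<phi> s) + (LINT s|lborel. D N s * \<psi> s)) =
      (\<lambda>N. LINT s|lborel. D N s * (\<phi> s + \<psi> s))"
    using assms by (simp add: distrib_left integrable_D_mult weakly_null_def)
  finally show "(\<lambda>N. LINT s|lborel. D N s * (\<phi> s + \<psi> s)) \<longlonglongrightarrow> 0" by simp
qed (use assms in \<open>auto simp: weakly_null_def\<close>)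

lemma weakly_null_cmult:
  assumes "weakly_null \<phi>"
  shows "weakly_null (\<lambda>s. c * \<phi> s)"
proof (rule weakly_nullI)
  have "integrable lborel (\<lambda>s. cmod c * (B s * cmod (\<phi> s)))"
    using assms by (auto simp: weakly_null_def)
  then show "integrable lborel (\<lambda>s. B s * cmod (c * \<phi> s))"
    by (simp add: norm_mult ac_simps)
  have "(\<lambda>N. c * (LINT s|lborel. D N s * \<phi> s)) \<longlonglongrightarrow> c * 0"
    using assms by (intro tendsto_mult) (auto simp: weakly_null_def)
  then show "(\<lambda>N. LINT s|lborel. D N s * (c * \<phi> s)) \<longlonglongrightarrow> 0"
    by (simp add: mult.left_commute)
qed (use assms in \<open>auto simp: weakly_null_def\<close>)

lemma weakly_null_0: "weakly_null (\<lambda>s. 0)"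
  by (simp add: weakly_null_def)

lemma weakly_null_sum:
  assumes "\<And>i. i \<in> I \<Longrightarrow> weakly_null (\<phi> i)"
  shows "weakly_null (\<lambda>s. \<Sum>i\<in>I. \<phi> i s)"
  using assms by (induction I rule: infinite_finite_induct)
    (auto simp: weakly_null_0 weakly_null_add)

text \<open>The weighted \<open>L1\<close> distance from \<open>\<phi> i\<close> to
  \<open>\<psi>\<close> bounds the error in the pairing with every \<open>D N\<close> at once, and
  dominated convergence sends it to 0. Limit and domination are asked only where \<open>B\<close> is
  nonzero, which later confines them to \<open>s > 0\<close>.\<close>

lemma weakly_null_lim:
  assumes \<phi>: "\<And>i. weakly_null (\<phi> i)"
    and w: "w \<in> borel_measurable borel" "integrable lborel (\<lambda>s. B s * w s)"
    and lim: "\<And>s. B s \<noteq> 0 \<Longrightarrow> (\<lambda>i. \<phi> i s) \<longlonglongrightarrow> \<psi> s"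
    and dom: "\<And>i s. B s \<noteq> 0 \<Longrightarrow> cmod (\<phi> i s) \<le> w s"
    and \<psi> [measurable]: "\<psi> \<in> borel_measurable borel"
  shows "weakly_null \<psi>"
proof (rule weakly_nullI)
  note [measurable] = \<phi>[THEN weakly_null_measurable] w(1)
  have \<psi>_le: "cmod (\<psi> s) \<le> w s" if "B s \<noteq> 0" for s
    by (rule tendsto_upperbound[OF tendsto_norm[OF lim[OF that]]]) (auto simp: dom that)
  have B\<psi>: "B s * cmod (\<psi> s) \<le> B s * w s" for s
    using \<psi>_le[of s] B_nonneg[of s] by (cases "B s = 0") auto
  show int: "integrable lborel (\<lambda>s. B s * cmod (\<psi> s))"
    by (rule Bochner_Integration.integrable_bound[OF w(2)])
       (auto simp: abs_mult B_nonneg intro!: AE_I2 order_trans[OF B\<psi>] mult_left_mono)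
  let ?E = "\<lambda>i. LINT s|lborel. B s * cmod (\<phi> i s - \<psi> s)"
  have intd: "integrable lborel (\<lambda>s. B s * cmod (\<phi> i s - \<psi> s))" for i
  proof (rule Bochner_Integration.integrable_bound)
    show "integrable lborel (\<lambda>s. B s * cmod (\<phi> i s) + B s * cmod (\<psi> s))"
      using \<phi> int by (auto simp: weakly_null_def)
    show "AE s in lborel. norm (B s * cmod (\<phi> i s - \<psi> s)) \<le> norm (B s * cmod (\<phi> i s) + B s * cmod (\<psi> s))"
      by (auto simp: abs_mult B_nonneg simp flip: distrib_left intro!: mult_left_mono norm_triangle_ineq4)
  qed measurable
  have E: "?E \<longlonglongrightarrow> (LINT s::real|lborel. 0)"
  proof (rule integral_dominated_convergence)
    show "integrable lborel (\<lambda>s. 2 * (B s * w s))" using w by simp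
    have "(\<lambda>i. B s * cmod (\<phi> i s - \<psi> s)) \<longlonglongrightarrow> 0" for s
    proof (cases "B s = 0")
      case False
      have "(\<lambda>i. B s * cmod (\<phi> i s - \<psi> s)) \<longlonglongrightarrow> B s * cmod (\<psi> s - \<psi> s)"
        by (intro tendsto_intros lim False)
      then show ?thesis by simp
    qed simp
    then show "AE s in lborel. (\<lambda>i. B s * cmod (\<phi> i s - \<psi> s)) \<longlonglongrightarrow> 0" by simp
    have "B s * cmod (\<phi> i s - \<psi> s) \<le> 2 * (B s * w s)" for i s
    proof (cases "B s = 0")
      case False
      then have "cmod (\<phi> i s - \<psi> s) \<le> 2 * w s"
        using norm_triangle_ineq4[of "\<phi> i s" "\<psi> s"] dom[of s i] \<psi>_le[of s] by auto
      from mult_left_mono[OF this B_nonneg[of s]] show ?thesis by simp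
    qed simp
    then show "AE s in lborel. norm (B s * cmod (\<phi> i s - \<psi> s)) \<le> 2 * (B s * w s)" for i
      by (auto simp: abs_mult B_nonneg)
  qed measurable
  show "(\<lambda>N. LINT s|lborel. D N s * \<psi> s) \<longlonglongrightarrow> 0"
  proof (rule LIMSEQ_I)
    fix r :: real assume "0 < r"
    \<comment> \<open>The index \<open>i\<close> is chosen before \<open>N\<close>; this works since
      \<open>?E i\<close> does not depend on \<open>N\<close>.\<close>
    then obtain i where i: "?E i < r / 2"
      using order_tendstoD(2)[OF E, of "r / 2"] by (auto simp: eventually_sequentially)
    have "(\<lambda>N. LINT s|lborel. D N s * \<phi> i s) \<longlonglongrightarrow> 0" using \<phi> by (simp add: weakly_null_def)
    from LIMSEQ_D[OF this, of "r / 2"] \<open>0 < r\<close>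
    obtain M where M: "cmod (LINT s|lborel. D N s * \<phi> i s) < r / 2" if "N \<ge> M" for N by auto
    have "cmod (LINT s|lborel. D N s * \<psi> s) < r" if "N \<ge> M" for N
    proof -
      have i1: "integrable lborel (\<lambda>s. D N s * \<phi> i s)" "integrable lborel (\<lambda>s. D N s * \<psi> s)"
        using \<phi>[of i] int by (auto intro!: integrable_D_mult simp: weakly_null_def)
      have "cmod ((LINT s|lborel. D N s * \<phi> i s) - (LINT s|lborel. D N s * \<psi> s)) =
          cmod (LINT s|lborel. D N s * (\<phi> i s - \<psi> s))"
        using i1 by (simp add: right_diff_distrib)
      also have "\<dots> \<le> ?E i"
        using i1 by (intro Bochner_Integration.integral_norm_bound_integral)
          (auto simp: intd right_diff_distrib[symmetric] norm_mult D_le intro!: mult_right_mono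
             intro: integrable_D_mult)
      finally have "cmod ((LINT s|lborel. D N s * \<psi> s)) \<le> ?E i + cmod (LINT s|lborel. D N s * \<phi> i s)"
        using norm_triangle_ineq3[of "LINT s|lborel. D N s * \<phi> i s" "LINT s|lborel. D N s * \<psi> s"] by linarith
      then show ?thesis using M[OF that] i by simp
    qed
    then show "\<exists>M. \<forall>N\<ge>M. norm ((LINT s|lborel. D N s * \<psi> s) - 0) < r" by auto
  qed
qed measurable

end

text \<open>The exponential moments of \<open>B\<close> make vanishing moments decisive: under
  polynomial moments alone, a nonzero function on the half line can have all its moments equal to 0.
  The powers \<open>s ^ k\<close> occur next to the exponential since Taylor expansion of test
  functions produces them.\<close>

locale vanishing_moments = dominated_sequence +
  fixes c :: real
  assumes c_pos: "0 < c"
    and B_nonpos: "\<And>s. s \<le> 0 \<Longrightarrow> B s = 0"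
    and B_exp_moments: "\<And>k. integrable lborel (\<lambda>s. B s * (s ^ k * exp (c * s)))"
    and moments_D: "\<And>n N. n \<le> N \<Longrightarrow> (LINT s|lborel. D N s * of_real (s ^ n)) = 0"
begin

lemma integrable_B_le:
  assumes [measurable]: "\<phi> \<in> borel_measurable borel"
    and "\<And>s. 0 < s \<Longrightarrow> cmod (\<phi> s) \<le> C * (s ^ k * exp (c * s))"
  shows "integrable lborel (\<lambda>s. B s * cmod (\<phi> s))"
proof (rule Bochner_Integration.integrable_bound)
  show "integrable lborel (\<lambda>s. C * (B s * (s ^ k * exp (c * s))))"
    using B_exp_moments by simp
  have "B s * cmod (\<phi> s) \<le> C * (B s * (s ^ k * exp (c * s)))" for s
    using mult_left_mono[OF assms(2) B_nonneg, of s s] B_nonpos[of s]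
    by (cases "s > 0") (auto simp: algebra_simps)
  then show "AE s in lborel. norm (B s * cmod (\<phi> s)) \<le> norm (C * (B s * (s ^ k * exp (c * s))))"
    by (auto simp: B_nonneg intro!: AE_I2 order_trans[OF _ abs_ge_self])
qed measurable

lemma weakly_null_power: "weakly_null (\<lambda>s. of_real (s ^ k))"
proof (rule weakly_nullI)
  show "integrable lborel (\<lambda>s. B s * cmod (of_real (s ^ k)))"
  proof (rule integrable_B_le)
    fix s :: real assume "0 < s"
    then show "cmod (of_real (s ^ k)) \<le> 1 * (s ^ k * exp (c * s))"
      using c_pos by (auto simp: norm_power)
  qed measurable
  show "(\<lambda>N. LINT s|lborel. D N s * of_real (s ^ k)) \<longlonglongrightarrow> 0"
    \<comment> \<open>The moment of order \<open>k\<close> of \<open>D N\<close> is exactly 0 from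
      \<open>N = k\<close> on.\<close>
    by (rule tendsto_eventually) (use moments_D[of k] in \<open>auto simp: eventually_sequentially\<close>)
qed measurable

text \<open>
  The Taylor series of \<open>exp (- c * s)\<close> converges in the weighted space only because \<open>B\<close> beats
  \<open>exp (- c * s)\<close>; larger exponents are reached in steps of size \<open>c\<close>.
\<close>

lemma weakly_null_power_exp: "weakly_null (\<lambda>s. of_real (s ^ k * exp (- (real m * c * s))))"
\<comment> \<open>\<open>k\<close> must vary: the Taylor terms of one further factor
  \<open>exp (- (c * s))\<close> multiply the power \<open>s ^ k\<close> by
  \<open>s ^ j\<close>.\<close>
proof (induction m arbitrary: k)
  case 0
  show ?case using weakly_null_power by simp
next
  case (Suc m)
  let ?t = "\<lambda>j s. (- (c * s)) ^ j / fact j"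
  show ?case
  proof (rule weakly_null_lim)
    fix i
    show "weakly_null (\<lambda>s. \<Sum>j<i. of_real ((- c) ^ j / fact j) *
        of_real (s ^ (k + j) * exp (- (real m * c * s))))"
      by (intro weakly_null_sum weakly_null_cmult Suc)
  next
    show "integrable lborel (\<lambda>s. B s * (s ^ k * exp (c * s)))" by (rule B_exp_moments)
  next
    fix s assume "B s \<noteq> 0"
    have eq: "(\<Sum>j<i. of_real ((- c) ^ j / fact j) * of_real (s ^ (k + j) * exp (- (real m * c * s)))) =
      (of_real ((\<Sum>j<i. ?t j s) * (s ^ k * exp (- (real m * c * s)))) :: complex)" for i
    proof -
      have "(- c) ^ j / fact j * (s ^ (k + j) * e) = ?t j s * (s ^ k * e)" for j e
      proof -
        have "(- (c * s)) ^ j = (- c) ^ j * s ^ j"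
          by (metis minus_mult_left power_mult_distrib)
        then show ?thesis by (simp add: power_add)
      qed
      then show ?thesis unfolding sum_distrib_right of_real_sum of_real_mult[symmetric] by (simp only:)
    qed
    have "(\<lambda>i. \<Sum>j<i. ?t j s) \<longlonglongrightarrow> exp (- (c * s))"
      using exp_converges[of "- (c * s)"] by (simp add: sums_def divide_inverse mult_ac)
    then have "(\<lambda>i. of_real ((\<Sum>j<i. ?t j s) * (s ^ k * exp (- (real m * c * s)))) :: complex)
       \<longlonglongrightarrow> of_real (exp (- (c * s)) * (s ^ k * exp (- (real m * c * s))))"
      by (intro tendsto_intros)
    also have "exp (- (c * s)) * (s ^ k * exp (- (real m * c * s))) = s ^ k * exp (- (real (Suc m) * c * s))"
      by (simp add: algebra_simps flip: exp_add)
    finally show "(\<lambda>i. \<Sum>j<i. of_real ((- c) ^ j / fact j) * of_real (s ^ (k + j) * exp (- (real m * c * s))))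
      \<longlonglongrightarrow> (of_real (s ^ k * exp (- (real (Suc m) * c * s))) :: complex)"
      unfolding eq .
    fix i
    have s: "s > 0" using B_nonpos[of s] \<open>B s \<noteq> 0\<close> by force
    \<comment> \<open>All partial sums of the alternating series are bounded by the series of
      absolute values, that is by \<open>exp (c * s)\<close>. The remaining factor
      \<open>exp (- (real m * c * s))\<close> is at most 1, so the majorant is the same for every
      \<open>m\<close>.\<close>
    have "\<bar>\<Sum>j<i. ?t j s\<bar> \<le> (\<Sum>j<i. (c * s) ^ j / fact j)"
      using s c_pos by (intro order_trans[OF sum_abs] sum_mono) (auto simp: power_abs abs_mult)
    also have "\<dots> \<le> exp (c * s)"
      using sum_le_suminf[OF summable_exp[of "c * s"], of "{..<i}"] s c_pos
      by (auto simp: exp_def divide_inverse mult_ac)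
    finally have "\<bar>\<Sum>j<i. ?t j s\<bar> * (s ^ k * exp (- (real m * c * s))) \<le> exp (c * s) * (s ^ k * 1)"
      using s c_pos by (intro mult_mono) auto
    then show "cmod (\<Sum>j<i. of_real ((- c) ^ j / fact j) * of_real (s ^ (k + j) * exp (- (real m * c * s))))
        \<le> s ^ k * exp (c * s)"
      unfolding eq norm_of_real using s by (simp add: abs_mult mult_ac)
  qed measurable
qed

lemma integrable_B: "integrable lborel B"
  using weakly_null_power[of 0] by (simp add: weakly_null_def)

text \<open>The substitution \<open>x = exp (- (c * s))\<close> maps the half line
  \<open>s > 0\<close> into \<open>{0..1}\<close>, and a polynomial in \<open>x\<close> is a
  combination of the exponentials already treated. Weierstrass approximation with errors at most 1
  keeps all approximants below \<open>K + 1\<close>, where \<open>K\<close> bounds \<open>f\<close>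
  on \<open>{0..1}\<close>.\<close>

lemma weakly_null_continuous:
  assumes f: "continuous_on UNIV (f :: real \<Rightarrow> real)"
  shows "weakly_null (\<lambda>s. of_real (f (exp (- (c * s)))))"
proof -
  have f01: "continuous_on {0..1} f" using f continuous_on_subset by blast
  have "\<exists>a n. \<forall>x\<in>{0..1}. \<bar>f x - (\<Sum>j\<le>n. a j * x ^ j)\<bar> < inverse (Suc i)" for i :: nat
  proof -
    obtain g where "real_polynomial_function g" and g: "\<And>x. x \<in> {0..1} \<Longrightarrow> \<bar>f x - g x\<bar> < inverse (Suc i)"
      using Stone_Weierstrass_real_polynomial_function[OF _ f01, of "inverse (Suc i)"] by auto
    then obtain a n where "g = (\<lambda>x. \<Sum>j\<le>n. a j * x ^ j)"
      unfolding real_polynomial_function_iff_sum by blast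
    with g show ?thesis by (intro exI[of _ a] exI[of _ n] ballI) blast
  qed
  then obtain a n where a:
    "\<And>i x. x \<in> {0..1} \<Longrightarrow> \<bar>f x - (\<Sum>j\<le>n i. a i j * x ^ j)\<bar> < inverse (Suc i)" by metis
  obtain K where K: "\<forall>x\<in>{0..1}. \<bar>f x\<bar> \<le> K"
    using compact_imp_bounded[OF compact_continuous_image[OF f01]] by (auto simp: bounded_iff)
  have eq: "(\<Sum>j\<le>n i. of_real (a i j) * of_real (s ^ 0 * exp (- (real j * c * s)))) =
      (of_real (\<Sum>j\<le>n i. a i j * exp (- (c * s)) ^ j) :: complex)" for i s
    by (simp add: exp_of_nat_mult[symmetric] mult_ac)
  show ?thesis
  proof (rule weakly_null_lim)
    show "weakly_null (\<lambda>s. \<Sum>j\<le>n i. of_real (a i j) * of_real (s ^ 0 * exp (- (real j * c * s))))" for i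
      by (intro weakly_null_sum weakly_null_cmult weakly_null_power_exp)
    show "integrable lborel (\<lambda>s. B s * (K + 1))" using integrable_B by simp
    fix s assume "B s \<noteq> 0"
    then have "s > 0" using B_nonpos[of s] by force
    then have t: "exp (- (c * s)) \<in> {0..1}" using c_pos by simp
    have "(\<lambda>i. (\<Sum>j\<le>n i. a i j * exp (- (c * s)) ^ j) - f (exp (- (c * s)))) \<longlonglongrightarrow> 0"
      by (rule Lim_null_comparison[OF _ LIMSEQ_inverse_real_of_nat])
         (use a[OF t] in \<open>auto simp: abs_minus_commute intro!: always_eventually less_imp_le\<close>)
    then have "(\<lambda>i. \<Sum>j\<le>n i. a i j * exp (- (c * s)) ^ j) \<longlonglongrightarrow> f (exp (- (c * s)))"
      unfolding LIM_zero_iff .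
    then show "(\<lambda>i. \<Sum>j\<le>n i. of_real (a i j) * of_real (s ^ 0 * exp (- (real j * c * s))))
        \<longlonglongrightarrow> (of_real (f (exp (- (c * s)))) :: complex)"
      unfolding eq by (rule tendsto_of_real)
    fix i
    have "inverse (real (Suc i)) \<le> 1" by (simp add: field_simps)
    then have "\<bar>\<Sum>j\<le>n i. a i j * exp (- (c * s)) ^ j\<bar> \<le> K + 1"
      using a[OF t, of i] bspec[OF K t] by linarith
    then show "cmod (\<Sum>j\<le>n i. of_real (a i j) * of_real (s ^ 0 * exp (- (real j * c * s)))) \<le> K + 1"
      unfolding eq norm_of_real .
  next
    \<comment> \<open>For \<open>s < 0\<close> the argument of \<open>f\<close> exceeds 1, so
      continuity on the whole line is what gives measurability of the composition.\<close>
    have [measurable]: "f \<in> borel_measurable borel" using f by (rule borel_measurable_continuous_onI)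
    show "(\<lambda>s. complex_of_real (f (exp (- (c * s))))) \<in> borel_measurable borel" by measurable
  qed measurable
qed

text \<open>In the decreasing variable \<open>t = exp (- (c * s))\<close> the half line
  \<open>{..x}\<close> becomes \<open>t \<ge> exp (- (c * x))\<close>, whose indicator is a
  pointwise limit of continuous ramps.\<close>

lemma weakly_null_indicator_atMost: "weakly_null (indicator {..x})"
proof (rule weakly_null_lim)
  \<comment> \<open>A ramp of slope \<open>i\<close> ending at \<open>t = exp (- (c * x))\<close>:
    it equals 1 from there on, including the endpoint, and for \<open>i > 0\<close> it is 0 once
    \<open>t\<close> lies at least \<open>1 / i\<close> below.\<close>
  define f where "f i t = min 1 (max 0 (1 + real i * (t - exp (- (c * x)))))" for i t
  show "weakly_null (\<lambda>s. of_real (f i (exp (- (c * s)))))" for i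
    unfolding f_def by (intro weakly_null_continuous continuous_intros)
  show "integrable lborel (\<lambda>s. B s * 1)" using integrable_B by simp
  show "cmod (of_real (f i (exp (- (c * s))))) \<le> 1" for i s
    by (auto simp: f_def)
  fix s
  show "(\<lambda>i. of_real (f i (exp (- (c * s))))) \<longlonglongrightarrow> (indicator {..x} s :: complex)"
  proof (cases "s \<le> x")
    case True
    then have "f i (exp (- (c * s))) = 1" for i using c_pos by (auto simp: f_def min_def max_def)
    then show ?thesis using True by simp
  next
    case False
    define d where "d = exp (- (c * x)) - exp (- (c * s))"
    have "d > 0" using False c_pos by (simp add: d_def)
    then obtain M :: nat where M: "1 < real M * d" using reals_Archimedean3 by blast
    have "f i (exp (- (c * s))) = 0" if "i \<ge> M" for i
    proof -
      have "real M * d \<le> real i * d" using that \<open>d > 0\<close> by simp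
      then have "1 + real i * (exp (- (c * s)) - exp (- (c * x))) \<le> 0"
        using M unfolding d_def by (simp add: algebra_simps)
      then show ?thesis by (simp add: f_def)
    qed
    then have "eventually (\<lambda>i. complex_of_real (f i (exp (- (c * s)))) = 0) sequentially"
      by (auto simp: eventually_sequentially)
    then show ?thesis using False by (simp add: tendsto_eventually)
  qed
qed measurable

text \<open>Dynkin's argument: half lines form a generator of the Borel sets that is stable under
  intersection. Complements use the constant function 1, and countable disjoint unions are dominated
  limits of their partial sums.\<close>

lemma weakly_null_indicator:
  assumes "A \<in> sets borel"
  shows "weakly_null (indicator A)"
proof -
  have "Int_stable (range (atMost :: real \<Rightarrow> _))"
    by (auto simp: Int_stable_def)
  moreover have "range atMost \<subseteq> Pow (UNIV :: real set)" by simp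
  moreover have "A \<in> sigma_sets UNIV (range atMost)"
    using assms by (simp add: borel_eq_atMost)
  ultimately show ?thesis
  proof (induction rule: sigma_sets_induct_disjoint)
    case (basic A)
    then show ?case using weakly_null_indicator_atMost by auto
  next
    case empty
    then show ?case using weakly_null_0 by simp
  next
    case (compl A)
    have "weakly_null (\<lambda>s. of_real (s ^ 0) + (- 1) * indicator A s)"
      by (intro weakly_null_add weakly_null_cmult weakly_null_power compl)
    also have "(\<lambda>s. of_real (s ^ 0) + (- 1) * indicator A s) = indicator (UNIV - A)"
      by (auto simp: indicator_def)
    finally show ?case .
  next
    case (union A)
    have A: "A i \<in> sets borel" for i using union(2) by (auto simp: borel_eq_atMost)
    show ?case
    proof (rule weakly_null_lim)
      show "weakly_null (\<lambda>s. \<Sum>j<i. indicator (A j) s)" for i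
        by (intro weakly_null_sum union)
      show "integrable lborel (\<lambda>s. B s * 1)" using integrable_B by simp
      \<comment> \<open>Disjointness turns each partial sum into an indicator, which supplies the
        common bound 1.\<close>
      have eq: "(\<Sum>j<i. indicator (A j) s) = (indicator (\<Union>j<i. A j) s :: complex)" for i s
        using union(1) by (intro indicator_UN_disjoint[symmetric]) (auto simp: disjoint_family_on_def)
      show "cmod (\<Sum>j<i. indicator (A j) s) \<le> 1" for i s
        unfolding eq by (simp add: indicator_def)
      show "(\<lambda>i. \<Sum>j<i. indicator (A j) s) \<longlonglongrightarrow> (indicator (\<Union>i. A i) s :: complex)" for s
        unfolding eq by (rule LIMSEQ_indicator_UN)
      show "(indicator (\<Union>i. A i) :: _ \<Rightarrow> complex) \<in> borel_measurable borel"
        using A by (intro borel_measurable_indicator sets.countable_UN) auto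
    qed measurable
  qed
qed

text \<open>Simple functions are dense: induction over the functions integrable for the measure with
  density \<open>B\<close> builds \<open>\<phi>\<close> from indicators by sums and dominated
  limits.\<close>

theorem weakly_null_all:
  assumes [measurable]: "\<phi> \<in> borel_measurable borel" and int: "integrable lborel (\<lambda>s. B s * cmod (\<phi> s))"
  shows "weakly_null \<phi>"
proof -
  let ?M = "density lborel (\<lambda>s. ennreal (B s))"
  have iff: "integrable ?M f \<longleftrightarrow> f \<in> borel_measurable borel \<and> integrable lborel (\<lambda>s. B s * cmod (f s))"
    for f :: "real \<Rightarrow> complex"
  proof (cases "f \<in> borel_measurable borel")
    case True
    then show ?thesis
      by (subst integrable_density)
         (auto simp: B_nonneg abs_mult simp flip: integrable_norm_iff[where f="\<lambda>s. B s *\<^sub>R f s"])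
  next
    case False
    then show ?thesis by (auto dest!: borel_measurable_integrable)
  qed
  have "integrable ?M \<phi>" using int iff by simp
  then show ?thesis
  proof (induction rule: integrable_induct)
    case (base A c)
    have "weakly_null (\<lambda>s. c * indicator A s)"
      using base by (intro weakly_null_cmult weakly_null_indicator) simp
    also have "(\<lambda>s. c * indicator A s) = (\<lambda>s. indicator A s *\<^sub>R c)"
      by (auto simp: indicator_def)
    finally show ?case .
  next
    case (add f g)
    then show ?case by (intro weakly_null_add)
  next
    case (lim f s)
    show ?case
    proof (rule weakly_null_lim)
      show "weakly_null (s i)" for i by (rule lim)
      show "integrable lborel (\<lambda>x. B x * (2 * cmod (f x)))"
        using \<open>integrable ?M f\<close> iff by (simp add: mult.left_commute[of _ 2])
      show "f \<in> borel_measurable borel" using \<open>integrable ?M f\<close> iff by blast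
      then show "(\<lambda>x. 2 * cmod (f x)) \<in> borel_measurable borel" by measurable
    qed (use lim in auto)
  qed
qed

end

section \<open>Radial integrals in the plane\<close>

lemma nn_integral_plane_scale:
  fixes f :: "real \<times> real \<Rightarrow> ennreal"
  assumes [measurable]: "f \<in> borel_measurable borel" and r: "0 < r"
  shows "(\<integral>\<^sup>+x. f x \<partial>lborel) = ennreal (r\<^sup>2) * (\<integral>\<^sup>+x. f (r *\<^sub>R x) \<partial>lborel)"
  using r by (subst lborel_affine[of r "0 :: real \<times> real"])
    (auto simp: nn_integral_density nn_integral_distr nn_integral_cmult power2_eq_square)

text \<open>This replaces polar coordinates. Scaling by \<open>sqrt x\<close> has Jacobian
  \<open>x\<close>, and homogeneity contributes \<open>x ^ n\<close>, so the mass of the disc of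
  squared radius \<open>x\<close> is a constant times \<open>x ^ Suc n\<close>. A measure on the
  line is determined by these values, and differentiating them gives the density.\<close>

lemma distr_norm_power2_homogeneous:
  fixes p :: "real \<times> real \<Rightarrow> real"
  assumes p [measurable]: "p \<in> borel_measurable borel"
    and nonneg: "\<And>x. 0 \<le> p x"
    and hom: "\<And>r x. 0 < r \<Longrightarrow> p (r *\<^sub>R x) = r ^ (2 * n) * p x"
    and le: "\<And>x. p x \<le> norm x ^ (2 * n)"
  obtains c where "0 \<le> c"
    "distr (density lborel (\<lambda>x. ennreal (p x))) borel (\<lambda>x. (norm x)\<^sup>2) =
       density lborel (\<lambda>s. ennreal (c * s ^ n * indicator {0<..} s))"
proof -
  let ?M = "distr (density lborel (\<lambda>x. ennreal (p x))) borel (\<lambda>x. (norm x)\<^sup>2)"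
  \<comment> \<open>The mass of the unit disc under the weight \<open>p\<close>; it is finite
    because \<open>p\<close> is at most 1 there.\<close>
  define m where "m = (\<integral>\<^sup>+x. ennreal (p x) * indicator {x. (norm x)\<^sup>2 \<le> 1} x \<partial>lborel)"
  have "m \<le> (\<integral>\<^sup>+x. indicator (cball (0 :: real \<times> real) 1) x \<partial>lborel)"
    unfolding m_def
  proof (intro nn_integral_mono)
    fix x :: "real \<times> real"
    show "ennreal (p x) * indicator {x. (norm x)\<^sup>2 \<le> 1} x \<le> indicator (cball 0 1) x"
      using order_trans[OF le power_le_one[OF norm_ge_zero]]
      by (auto simp: indicator_def power2_le_iff_abs_le abs_le_square_iff[symmetric] power_le_one_iff)
  qed
  also have "\<dots> < \<infinity>" using emeasure_lborel_cball_finite[of "0 :: real \<times> real" 1] by simp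
  finally have m: "ennreal (enn2real m) = m" by simp
  \<comment> \<open>The factor \<open>Suc n\<close> comes from differentiating
    \<open>enn2real m * x ^ Suc n\<close>.\<close>
  define c where "c = real (Suc n) * enn2real m"
  let ?N = "density lborel (\<lambda>s. ennreal (c * s ^ n * indicator {0<..} s))"
  have M_le: "emeasure ?M {..x} = ennreal (if 0 < x then enn2real m * x ^ Suc n else 0)" for x
  proof -
    have eq: "emeasure ?M {..x} = (\<integral>\<^sup>+y. ennreal (p y) * indicator {y. (norm y)\<^sup>2 \<le> x} y \<partial>lborel)"
      by (subst emeasure_distr) (auto simp: emeasure_density vimage_def)
    show ?thesis
    proof (cases "0 < x")
      case True
      define r where "r = sqrt x"
      have r: "0 < r" "r\<^sup>2 = x" using True by (auto simp: r_def)
      have "emeasure ?M {..x} =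
          ennreal (r\<^sup>2) * (\<integral>\<^sup>+y. ennreal (p (r *\<^sub>R y)) * indicator {y. (norm y)\<^sup>2 \<le> x} (r *\<^sub>R y) \<partial>lborel)"
        unfolding eq by (rule nn_integral_plane_scale) (use r in auto)
      also have "(\<lambda>y. ennreal (p (r *\<^sub>R y)) * indicator {y. (norm y)\<^sup>2 \<le> x} (r *\<^sub>R y)) =
          (\<lambda>y :: real \<times> real. ennreal (x ^ n) * (ennreal (p y) * indicator {y. (norm y)\<^sup>2 \<le> 1} y))"
        using r True
        by (auto simp: fun_eq_iff hom indicator_def power_mult_distrib power_mult ennreal_mult nonneg abs_square_le_1
             simp flip: r(2))
      also have "ennreal (r\<^sup>2) * (\<integral>\<^sup>+y. ennreal (x ^ n) * (ennreal (p y) * indicator {y. (norm y)\<^sup>2 \<le> 1} y) \<partial>lborel)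
          = ennreal x * (ennreal (x ^ n) * m)"
        unfolding m_def by (subst nn_integral_cmult) (auto simp: r)
      also have "\<dots> = ennreal (enn2real m * x ^ Suc n)"
        by (subst m[symmetric]) (use True in \<open>simp add: ennreal_mult[symmetric] mult_ac\<close>)
      finally show ?thesis using True by simp
    next
      case False
      \<comment> \<open>For \<open>x \<le> 0\<close> the preimage contains at most the origin, a
        null set.\<close>
      have "emeasure ?M {..x} = (\<integral>\<^sup>+y. 0 \<partial>(lborel :: (real \<times> real) measure))"
        unfolding eq
      proof (intro nn_integral_cong_AE)
        have "AE y in lborel. y \<noteq> (0 :: real \<times> real)" by (rule AE_lborel_singleton)
        then show "AE y in lborel. ennreal (p y) * indicator {y. (norm y)\<^sup>2 \<le> x} y = 0"
        proof eventually_elim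
          case (elim y)
          then have "0 < (norm y)\<^sup>2" by simp
          then have "\<not> (norm y)\<^sup>2 \<le> x" using False by linarith
          then show ?case by simp
        qed
      qed
      then show ?thesis using False by simp
    qed
  qed
  have N_le: "emeasure ?N {..x} = ennreal (if 0 < x then enn2real m * x ^ Suc n else 0)" for x
  proof -
    have "emeasure ?N {..x} = (\<integral>\<^sup>+s. ennreal (c * s ^ n * indicator {0<..} s) * indicator {..x} s \<partial>lborel)"
      by (subst emeasure_density) auto
    also have "\<dots> = (\<integral>\<^sup>+s. ennreal (c * s ^ n) * indicator {0..x} s \<partial>lborel)"
      using AE_lborel_singleton[of "0 :: real"]
      by (intro nn_integral_cong_AE, eventually_elim) (auto simp: indicator_def)
    also have "\<dots> = ennreal (if 0 < x then enn2real m * x ^ Suc n else 0)"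
    proof (cases "0 < x")
      case True
      have "(\<integral>\<^sup>+s. ennreal (c * s ^ n) * indicator {0..x} s \<partial>lborel) =
          ennreal (enn2real m * x ^ Suc n - enn2real m * 0 ^ Suc n)"
      proof (rule nn_integral_FTC_Icc)
        fix s assume s: "s \<in> {0..x}"
        show "((\<lambda>s. enn2real m * s ^ Suc n) has_real_derivative c * s ^ n) (at s)"
          unfolding c_def
          by (auto intro!: derivative_eq_intros simp del: power_Suc)
        show "0 \<le> c * s ^ n" using s by (simp add: c_def)
      qed (use True in auto)
      then show ?thesis using True by simp
    next
      case False
      have "(\<integral>\<^sup>+s. ennreal (c * s ^ n) * indicator {0..x} s \<partial>lborel) = (\<integral>\<^sup>+s. 0 \<partial>(lborel :: real measure))"
      proof (rule nn_integral_cong_AE)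
        show "AE s in lborel. ennreal (c * s ^ n) * indicator {0..x} s = 0"
          using AE_lborel_singleton[of "0 :: real"]
          by eventually_elim (use False in \<open>auto simp: indicator_def\<close>)
      qed
      then show ?thesis using False by simp
    qed
    finally show ?thesis .
  qed
  have "?M = ?N"
  proof (rule measure_eqI_generator_eq)
    show "Int_stable (range (atMost :: real \<Rightarrow> _))" by (auto simp: Int_stable_def)
    show "range (\<lambda>i. {..real i}) \<subseteq> range atMost" by auto
    show "(\<Union>i. {..real i}) = UNIV" by (auto intro: real_arch_simple)
    show "emeasure ?M {..real i} \<noteq> \<infinity>" for i unfolding M_le by simp
    show "emeasure ?M X = emeasure ?N X" if "X \<in> range atMost" for X
      using that M_le N_le by auto
  qed (auto simp: borel_eq_atMost)
  moreover have "0 \<le> c" by (simp add: c_def)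
  ultimately show ?thesis by (rule that[rotated])
qed

lemma set_integral_power_exp:
  assumes a: "0 < (a::real)"
  shows set_integrable_power_exp: "set_integrable lborel {0<..} (\<lambda>s. s ^ n * exp (- (s / a)))"
    and "(LINT s:{0<..}|lborel. s ^ n * exp (- (s / a))) = fact n * a ^ Suc n"
proof -
  have "has_bochner_integral lborel
      (\<lambda>s. (0 + (1/a) * s) ^ n * exp (- (0 + (1/a) * s)) * indicator {0<..} (0 + (1/a) * s)) (fact n /\<^sub>R \<bar>1/a\<bar>)"
    by (rule lborel_has_bochner_integral_real_affine_iff[THEN iffD1, OF _ has_bochner_integral_I0i_power_exp_m])
       (use a in simp)
  then have "has_bochner_integral lborel
      (\<lambda>s. a ^ n * ((0 + (1/a) * s) ^ n * exp (- (0 + (1/a) * s)) * indicator {0<..} (0 + (1/a) * s)))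
      (a ^ n * (fact n /\<^sub>R \<bar>1/a\<bar>))"
    by (rule has_bochner_integral_mult_right)
  also have "a ^ n * (fact n /\<^sub>R \<bar>1/a\<bar>) = fact n * a ^ Suc n" using a by (simp add: field_simps)
  also have "(\<lambda>s. a ^ n * ((0 + (1/a) * s) ^ n * exp (- (0 + (1/a) * s)) * indicator {0<..} (0 + (1/a) * s))) =
      (\<lambda>s. indicator {0<..} s *\<^sub>R (s ^ n * exp (- (s / a))))"
    using a by (auto simp: indicator_def field_simps zero_less_divide_iff)
  finally show "set_integrable lborel {0<..} (\<lambda>s. s ^ n * exp (- (s / a)))"
     "(LINT s:{0<..}|lborel. s ^ n * exp (- (s / a))) = fact n * a ^ Suc n"
    by (auto simp: set_integrable_def set_lebesgue_integral_def has_bochner_integral_iff)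
qed

text \<open>The identity of measures enters as a hypothesis so that a single constant
  \<open>c\<close> serves all integrands \<open>F\<close>; a special \<open>F\<close> can then be
  used to compute it.\<close>

lemma integral_homogeneous_radial:
  fixes p :: "real \<times> real \<Rightarrow> real" and F :: "real \<Rightarrow> 'a::{banach, second_countable_topology}"
  assumes [measurable]: "p \<in> borel_measurable borel" "F \<in> borel_measurable borel"
    and nonneg: "\<And>x. 0 \<le> p x" and c: "0 \<le> c"
    and distr: "distr (density lborel (\<lambda>x. ennreal (p x))) borel (\<lambda>x. (norm x)\<^sup>2) =
       density lborel (\<lambda>s. ennreal (c * s ^ n * indicator {0<..} s))"
  shows "(LINT x|lborel. p x *\<^sub>R F ((norm x)\<^sup>2)) = c *\<^sub>R (LINT s:{0<..}|lborel. s ^ n *\<^sub>R F s)"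
    and "set_integrable lborel {0<..} (\<lambda>s. s ^ n *\<^sub>R F s) \<Longrightarrow>
      integrable lborel (\<lambda>x. p x *\<^sub>R F ((norm x)\<^sup>2))"
proof -
  let ?M = "distr (density lborel (\<lambda>x. ennreal (p x))) borel (\<lambda>x. (norm x)\<^sup>2)"
  have nn: "0 \<le> c * s ^ n * indicator {0<..} s" for s :: real using c by (auto simp: indicator_def)
  have eq: "(c * s ^ n * indicator {0<..} s) *\<^sub>R F s = c *\<^sub>R (indicator {0<..} s *\<^sub>R (s ^ n *\<^sub>R F s))" for s
    by simp
  have "(LINT x|lborel. p x *\<^sub>R F ((norm x)\<^sup>2)) = integral\<^sup>L ?M F"
    by (simp add: integral_distr integral_density nonneg)
  also have "\<dots> = c *\<^sub>R (LINT s:{0<..}|lborel. s ^ n *\<^sub>R F s)"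
    unfolding distr by (subst integral_density) (auto simp: nn eq set_lebesgue_integral_def simp del: scaleR_scaleR)
  finally show "(LINT x|lborel. p x *\<^sub>R F ((norm x)\<^sup>2)) = c *\<^sub>R (LINT s:{0<..}|lborel. s ^ n *\<^sub>R F s)" .
  assume "set_integrable lborel {0<..} (\<lambda>s. s ^ n *\<^sub>R F s)"
  then have "integrable ?M F"
    unfolding distr by (subst integrable_density) (auto simp: nn eq set_integrable_def simp del: scaleR_scaleR)
  then show "integrable lborel (\<lambda>x. p x *\<^sub>R F ((norm x)\<^sup>2))"
    by (simp add: integrable_distr_eq integrable_density nonneg)
qed

section \<open>Even moments of radial functions over the quadrant\<close>

lemma norm_prod_power2: "(norm (x :: real \<times> real))\<^sup>2 = (fst x)\<^sup>2 + (snd x)\<^sup>2"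
  by (simp add: norm_prod_def)

text \<open>The weight \<open>x1 ^ (2 * n)\<close> on the open quadrant is homogeneous, so the
  planar moment is a universal multiple of the \<open>n\<close>-th moment of \<open>F\<close>. A
  Gaussian, for which both sides are explicit, determines the multiple.\<close>

lemma quadrant_moment:
  fixes F :: "real \<Rightarrow> complex"
  assumes [measurable]: "F \<in> borel_measurable borel"
    and int: "set_integrable lborel {0<..} (\<lambda>s. s ^ n *\<^sub>R F s)"
  shows "(LINT y:{0<..}|lborel. LINT x:{0<..}|lborel. x ^ (2 * n) *\<^sub>R F (x\<^sup>2 + y\<^sup>2)) =
    (pi / 4 * (fact (2 * n) / (4 ^ n * (fact n)\<^sup>2))) *\<^sub>R (LINT s:{0<..}|lborel. s ^ n *\<^sub>R F s)"
proof -
  define p :: "real \<times> real \<Rightarrow> real"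
    where "p x = indicator {0<..} (fst x) * indicator {0<..} (snd x) * fst x ^ (2 * n)" for x
  have p [measurable]: "p \<in> borel_measurable borel"
    unfolding p_def borel_prod[symmetric] by measurable
  have p_nonneg: "0 \<le> p x" for x by (simp add: p_def)
  have p_hom: "p (r *\<^sub>R x) = r ^ (2 * n) * p x" if "0 < r" for r x
    using that by (auto simp: p_def indicator_def power_mult_distrib zero_less_mult_iff)
  have p_le: "p x \<le> norm x ^ (2 * n)" for x
  proof -
    have "\<bar>fst x\<bar> ^ (2 * n) \<le> norm x ^ (2 * n)"
      using norm_fst_le[of "fst x" "snd x"] by (intro power_mono) (auto simp: power_even_abs)
    then show ?thesis by (auto simp: p_def indicator_def power_even_abs)
  qed
  obtain c where c: "0 \<le> c" and distr:
    "distr (density lborel (\<lambda>x. ennreal (p x))) borel (\<lambda>x. (norm x)\<^sup>2) =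
       density lborel (\<lambda>s. ennreal (c * s ^ n * indicator {0<..} s))"
    by (rule distr_norm_power2_homogeneous[OF p p_nonneg p_hom p_le])
  \<comment> \<open>Kept general in \<open>G\<close>: it is applied to \<open>exp (- s)\<close> to
    find \<open>c\<close>, and then to \<open>F\<close>.\<close>
  have iterated: "(LINT y:{0<..}|lborel. LINT x:{0<..}|lborel. x ^ (2 * n) *\<^sub>R G (x\<^sup>2 + y\<^sup>2)) =
      c *\<^sub>R (LINT s:{0<..}|lborel. s ^ n *\<^sub>R G s)"
    if [measurable]: "G \<in> borel_measurable borel"
      and int: "set_integrable lborel {0<..} (\<lambda>s. s ^ n *\<^sub>R G s)" for G :: "real \<Rightarrow> complex"
  proof -
    note radial = integral_homogeneous_radial[OF p \<open>G \<in> borel_measurable borel\<close> p_nonneg c distr]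
    have "integrable (lborel \<Otimes>\<^sub>M lborel) (\<lambda>(x, y). p (x, y) *\<^sub>R G (x\<^sup>2 + y\<^sup>2))"
      using radial(2)[OF int] by (simp add: lborel_prod norm_prod_power2 case_prod_unfold)
    from lborel_pair.integral_snd[OF this]
    have "(LINT y|lborel. LINT x|lborel. p (x, y) *\<^sub>R G (x\<^sup>2 + y\<^sup>2)) = c *\<^sub>R (LINT s:{0<..}|lborel. s ^ n *\<^sub>R G s)"
      using radial(1) by (simp add: lborel_prod norm_prod_power2 case_prod_unfold)
    also have "(\<lambda>y. LINT x|lborel. p (x, y) *\<^sub>R G (x\<^sup>2 + y\<^sup>2)) =
        (\<lambda>y. indicator {0<..} y *\<^sub>R (LINT x|lborel. indicator {0<..} x *\<^sub>R (x ^ (2 * n) *\<^sub>R G (x\<^sup>2 + y\<^sup>2))))"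
      by (auto simp: fun_eq_iff p_def indicator_def)
    finally show ?thesis by (simp add: set_lebesgue_integral_def)
  qed
  \<comment> \<open>For \<open>exp (- s)\<close> the right side is \<open>c * fact n\<close>, while
    the left side splits into two Gaussian integrals over half lines, one carrying the factor
    \<open>x ^ (2 * n)\<close>.\<close>
  have c_eq: "c = pi / 4 * (fact (2 * n) / (4 ^ n * (fact n)\<^sup>2))"
  proof -
    let ?A = "(sqrt pi / 2) * (fact (2 * n) / (2 ^ (2 * n) * fact n))"
    have half_line: "(LINT x:{0::real<..}|lborel. exp (-x\<^sup>2) * x ^ (2 * k)) =
        (sqrt pi / 2) * (fact (2 * k) / (2 ^ (2 * k) * fact k))" for k :: nat
    proof -
      have "(LINT x:{0::real<..}|lborel. exp (-x\<^sup>2) * x ^ (2 * k)) =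
          (LINT x|lborel. indicator {0..} x *\<^sub>R (exp (-x\<^sup>2) * x ^ (2 * k)))"
        unfolding set_lebesgue_integral_def
      proof (rule integral_cong_AE)
        show "AE x in lborel. indicator {0<..} (x::real) *\<^sub>R (exp (-x\<^sup>2) * x ^ (2 * k)) =
            indicator {0..} x *\<^sub>R (exp (-x\<^sup>2) * x ^ (2 * k))"
          using AE_lborel_singleton[of "0 :: real"] by eventually_elim (auto simp: indicator_def)
      qed measurable
      then show ?thesis using has_bochner_integral_integral_eq[OF gaussian_moment_even_pos[of k]] by simp
    qed
    have E: "set_integrable lborel {0<..} (\<lambda>s. s ^ n *\<^sub>R complex_of_real (exp (- s)))"
      using set_integrable_power_exp[of 1 n]
      by (simp add: set_integrable_def scaleR_conv_of_real flip: of_real_mult of_real_power)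
    have "c *\<^sub>R (LINT s:{0<..}|lborel. s ^ n *\<^sub>R complex_of_real (exp (- s))) = of_real c * fact n"
      using set_integral_power_exp(2)[of 1 n]
      by (simp add: set_lebesgue_integral_def scaleR_conv_of_real flip: of_real_mult of_real_power)
    moreover have "(LINT y:{0<..}|lborel. LINT x:{0<..}|lborel. x ^ (2 * n) *\<^sub>R complex_of_real (exp (- (x\<^sup>2 + y\<^sup>2))))
        = of_real (?A * (sqrt pi / 2))"
    proof -
      have inner: "(LINT x:{0<..}|lborel. x ^ (2 * n) *\<^sub>R complex_of_real (exp (- (x\<^sup>2 + y\<^sup>2)))) = of_real (?A * exp (- y\<^sup>2))" for y
      proof -
        have "(LINT x:{0<..}|lborel. x ^ (2 * n) *\<^sub>R complex_of_real (exp (- (x\<^sup>2 + y\<^sup>2)))) =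
            (LINT x|lborel. of_real (exp (- y\<^sup>2) * (indicator {0<..} x * (exp (- x\<^sup>2) * x ^ (2 * n)))))"
          unfolding set_lebesgue_integral_def
          by (intro Bochner_Integration.integral_cong) (auto simp: scaleR_conv_of_real exp_add exp_diff exp_minus field_simps)
        also have "\<dots> = of_real (exp (- y\<^sup>2) * ?A)"
          using half_line[of n] by (simp add: set_lebesgue_integral_def del: of_real_mult)
        finally show ?thesis by (simp add: mult.commute)
      qed
      have "(LINT y:{0<..}|lborel. LINT x:{0<..}|lborel. x ^ (2 * n) *\<^sub>R complex_of_real (exp (- (x\<^sup>2 + y\<^sup>2))))
        = (LINT y|lborel. of_real (?A * (indicator {0<..} y * exp (- y\<^sup>2))))"
        unfolding inner unfolding set_lebesgue_integral_def
        by (intro Bochner_Integration.integral_cong) (auto simp: indicator_def)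
      also have "\<dots> = of_real (?A * (LINT y:{0::real<..}|lborel. exp (- y\<^sup>2)))"
        by (simp only: integral_complex_of_real integral_mult_right_zero set_lebesgue_integral_def real_scaleR_def)
      also have "(LINT y:{0::real<..}|lborel. exp (- y\<^sup>2)) = sqrt pi / 2"
        using half_line[of 0] by simp
      finally show ?thesis .
    qed
    ultimately have "complex_of_real (c * fact n) = of_real (?A * (sqrt pi / 2))"
      using iterated[OF _ E] by simp
    then have "c * fact n = ?A * (sqrt pi / 2)" by (simp only: of_real_eq_iff)
    also have "\<dots> = pi / 4 * (fact (2 * n) / (4 ^ n * fact n))"
      by (simp add: power_mult)
    finally show ?thesis by (simp add: power2_eq_square field_simps)
  qed
  show ?thesis using iterated[OF assms] unfolding c_eq .
qed

section \<open>The control operator in the radial variable\<close>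

lemma integrable_mult_pair:
  fixes a b :: "real \<Rightarrow> real"
  assumes a: "integrable lborel a" and b: "integrable lborel b"
  shows "integrable (lborel \<Otimes>\<^sub>M lborel) (\<lambda>(x, y). a x * b y)"
proof (rule lborel_pair.Fubini_integrable)
  note [measurable] = borel_measurable_integrable[OF a] borel_measurable_integrable[OF b]
  show "(\<lambda>(x, y). a x * b y) \<in> borel_measurable (lborel \<Otimes>\<^sub>M lborel)" by measurable
  show "integrable lborel (\<lambda>x. LINT y|lborel. norm (case (x, y) of (x, y) \<Rightarrow> a x * b y))"
    using a b by (simp add: abs_mult)
qed (use b in simp)

text \<open>This is the absolute convergence of Euler's integral for the Gamma function at
  \<open>p + 1\<close>.\<close>

lemma integrable_powr_exp:
  assumes p: "- 1 < (p::real)" and b: "0 < (b::real)"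
  shows "integrable lborel (\<lambda>s. indicator {0<..} s * (s powr p * exp (- (b * s))))"
proof -
  have "(\<lambda>t. complex_of_real t powr (of_real (p + 1) - 1) / of_real (exp (b * t))) absolutely_integrable_on {0<..}"
    by (rule absolutely_integrable_Gamma_integral) (use p b in auto)
  then have "(\<lambda>t. norm (complex_of_real t powr (of_real (p + 1) - 1) / of_real (exp (b * t)))) absolutely_integrable_on {0<..}"
    by (rule absolutely_integrable_norm[unfolded comp_def])
  then have "integrable lebesgue (\<lambda>t. indicator {0<..} t * norm (complex_of_real t powr (of_real (p + 1) - 1) / of_real (exp (b * t))))"
    by (simp add: set_integrable_def)
  also have "(\<lambda>t. indicator {0<..} t * norm (complex_of_real t powr (of_real (p + 1) - 1) / of_real (exp (b * t)))) =
      (\<lambda>s. indicator {0<..} s * (s powr p * exp (- (b * s))))"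
    by (auto simp: fun_eq_iff indicator_def norm_divide powr_of_real norm_mult norm_inverse exp_minus divide_inverse)
  finally show ?thesis by (subst (asm) integrable_completion) auto
qed

text \<open>This is \<open>2 * pi\<close> times the planar heat kernel at time \<open>\<xi>\<close>,
  as a function of the squared radius \<open>s\<close>. The indicators extend it by 0, so that all
  integrals run over the whole line and Fubini applies directly.\<close>

definition heat_kernel :: "real \<Rightarrow> real \<Rightarrow> real \<Rightarrow> real" where
  "heat_kernel T s \<xi> = indicator {0<..} s * (indicator {0<..<T} \<xi> * (1 / (2 * \<xi>) * exp (- s / (4 * \<xi>))))"

text \<open>\<open>w\<close> is the control in reversed time,
  \<open>w \<xi> = u (T - \<xi>)\<close>.\<close>

definition control_profile :: "real \<Rightarrow> (real \<Rightarrow> complex) \<Rightarrow> real \<Rightarrow> complex" where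
  "control_profile T w s = - (1 / pi) *\<^sub>R (LINT \<xi>|lborel. heat_kernel T s \<xi> *\<^sub>R w \<xi>)"

text \<open>The time factor of a product majorant of the kernel; the exponent is above
  \<open>-1\<close>, hence integrable at 0.\<close>

definition time_weight :: "real \<Rightarrow> real \<Rightarrow> real" where
  "time_weight T \<xi> = indicator {0<..<T} \<xi> * \<xi> powr (- 3 / 4)"

text \<open>The space factor of that majorant. The exponent \<open>- 1 / 4\<close> leaves it square
  integrable at 0 and also covers the logarithmic singularity of the target; the rate
  \<open>1 / (8 * T)\<close> is half the Gaussian rate at time \<open>T\<close>.\<close>

definition space_weight :: "real \<Rightarrow> real \<Rightarrow> real" where
  "space_weight T s = indicator {0<..} s * (s powr (- 1 / 4) * exp (- (1 / (8 * T) * s)))"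

lemma heat_kernel_measurable [measurable]:
  assumes [measurable]: "f \<in> borel_measurable M" "g \<in> borel_measurable M"
  shows "(\<lambda>x. heat_kernel T (f x) (g x)) \<in> borel_measurable M"
  unfolding heat_kernel_def by measurable

lemma control_profile_measurable [measurable]:
  assumes [measurable]: "w \<in> borel_measurable borel"
  shows "control_profile T w \<in> borel_measurable borel"
  unfolding control_profile_def by measurable

lemma space_weight_measurable [measurable]: "space_weight T \<in> borel_measurable borel"
  unfolding space_weight_def by measurable

lemma time_weight_measurable [measurable]: "time_weight T \<in> borel_measurable borel"
  unfolding time_weight_def by measurable

lemma heat_kernel_nonneg: "0 \<le> heat_kernel T s \<xi>"
  by (auto simp: heat_kernel_def indicator_def)

lemma time_weight_nonneg: "0 \<le> time_weight T \<xi>"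
  by (auto simp: time_weight_def indicator_def)

lemma space_weight_nonneg: "0 \<le> space_weight T s"
  by (auto simp: space_weight_def indicator_def)

text \<open>Half of the exponential is traded for a power:
  \<open>exp (- (y / 2)) \<le> y powr (- 1 / 4)\<close> amounts to
  \<open>ln y \<le> 2 * y\<close>.\<close>

lemma exp_uminus_le_powr:
  assumes "0 < (y::real)"
  shows "exp (- y) \<le> y powr (- 1 / 4) * exp (- (y / 2))"
proof -
  have "exp (- y) = exp (- (y / 2)) * exp (- (y / 2))" by (simp flip: exp_add)
  also have "\<dots> \<le> y powr (- 1 / 4) * exp (- (y / 2))"
    using ln_le_minus_one[OF assms] assms by (intro mult_right_mono) (auto simp: powr_def)
  finally show ?thesis .
qed

text \<open>With \<open>y = s / (4 * \<xi>)\<close>, the factor \<open>y powr (- 1 / 4)\<close>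
  lowers the singularity in time from \<open>1 / \<xi>\<close> to the exponent
  \<open>- 3 / 4\<close>, at the price of a mild singularity in \<open>s\<close>. The rest of the
  exponential is estimated by \<open>\<xi> < T\<close>, and the variables separate.\<close>

lemma heat_kernel_le: "heat_kernel T s \<xi> \<le> time_weight T \<xi> * space_weight T s"
proof (cases "0 < s \<and> 0 < \<xi> \<and> \<xi> < T")
  case True
  define y where "y = s / (4 * \<xi>)"
  have y: "0 < y" using True by (simp add: y_def)
  have "exp (- y) \<le> y powr (- 1 / 4) * exp (- (y / 2))" by (rule exp_uminus_le_powr[OF y])
  also have "\<dots> \<le> y powr (- 1 / 4) * exp (- (1 / (8 * T) * s))"
    using True by (intro mult_left_mono) (auto simp: y_def field_simps)
  finally have "1 / (2 * \<xi>) * exp (- y) \<le> 1 / (2 * \<xi>) * (y powr (- 1 / 4) * exp (- (1 / (8 * T) * s)))"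
    using True by (intro mult_left_mono) auto
  also have "1 / (2 * \<xi>) * (y powr (- 1 / 4) * exp (- (1 / (8 * T) * s))) =
     (4 powr (1 / 4) / 2) * ((\<xi> powr (1 / 4) / \<xi>) * (s powr (- 1 / 4) * exp (- (1 / (8 * T) * s))))"
    using True by (simp add: y_def powr_divide powr_mult powr_minus field_simps)
  also have "\<xi> powr (1 / 4) / \<xi> = \<xi> powr (- 3 / 4)"
    using True powr_diff[of \<xi> "1/4" 1] by simp
  also have "(4 powr (1 / 4) / 2) * (\<xi> powr (- 3 / 4) * (s powr (- 1 / 4) * exp (- (1 / (8 * T) * s))))
      \<le> 1 * (\<xi> powr (- 3 / 4) * (s powr (- 1 / 4) * exp (- (1 / (8 * T) * s))))"
  proof (intro mult_right_mono)
    have "(4::real) powr (1 / 4) \<le> 4 powr (1 / 2)" by (intro powr_mono) auto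
    also have "\<dots> = 2" by (simp add: powr_half_sqrt)
    finally show "(4::real) powr (1 / 4) / 2 \<le> 1" by simp
  qed auto
  finally show ?thesis using True by (simp add: heat_kernel_def time_weight_def space_weight_def y_def)
qed (auto simp: heat_kernel_def time_weight_def space_weight_def indicator_def)

text \<open>On \<open>\<xi> < T\<close> the factor \<open>exp (T - \<xi>)\<close> is at least 1, so
  \<open>exp T\<close> times a Gamma integrand is a majorant.\<close>

lemma integrable_time_weight: "integrable lborel (time_weight T)"
proof -
  have "integrable lborel (\<lambda>\<xi>. exp T * (indicator {0<..} \<xi> * (\<xi> powr (- 3 / 4) * exp (- (1 * \<xi>)))))"
    by (intro integrable_mult_right integrable_powr_exp) auto
  then show ?thesis
  proof (rule Bochner_Integration.integrable_bound)
    have "\<xi> powr (- 3 / 4) \<le> exp T * (\<xi> powr (- 3 / 4) * exp (- \<xi>))" if "\<xi> < T" for \<xi>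
    proof -
      have "\<xi> powr (- 3 / 4) * 1 \<le> \<xi> powr (- 3 / 4) * exp (T - \<xi>)"
        using that by (intro mult_left_mono) auto
      then show ?thesis by (simp add: exp_diff exp_minus field_simps)
    qed
    then show "AE \<xi> in lborel. norm (time_weight T \<xi>) \<le>
        norm (exp T * (indicator {0<..} \<xi> * (\<xi> powr (- 3 / 4) * exp (- (1 * \<xi>)))))"
      by (intro AE_I2) (auto simp: time_weight_def indicator_def)
  qed measurable
qed

text \<open>The growth \<open>exp (1 / (16 * T) * s)\<close> uses up only half of the decay of the
  weight; this rate becomes the constant \<open>c\<close> of \<open>vanishing_moments\<close>.
  Squaring the weight gives the exponent \<open>- 1 / 2\<close>, still integrable at 0.\<close>

lemma integrable_space_weight_mult:
  assumes "0 < T"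
  shows "integrable lborel (\<lambda>s. space_weight T s * (s ^ k * exp (1 / (16 * T) * s)))"
    and "integrable lborel (\<lambda>s. space_weight T s * space_weight T s)"
proof -
  have "integrable lborel (\<lambda>s. indicator {0<..} s * (s powr (real k - 1 / 4) * exp (- (1 / (16 * T) * s))))"
    by (rule integrable_powr_exp) (use assms in auto)
  also have "(\<lambda>s. indicator {0<..} s * (s powr (real k - 1 / 4) * exp (- (1 / (16 * T) * s)))) =
      (\<lambda>s. space_weight T s * (s ^ k * exp (1 / (16 * T) * s)))"
  proof
    fix s :: real
    have "exp (- (1 / (16 * T) * s)) = exp (- (1 / (8 * T) * s)) * exp (1 / (16 * T) * s)"
      using assms by (simp add: field_simps flip: exp_add)
    moreover have "s powr (real k - 1 / 4) = s powr (- 1 / 4) * s ^ k" if "0 < s"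
      using powr_add[of s "- 1 / 4" "real k"] that by (simp add: powr_realpow)
    ultimately show "indicator {0<..} s * (s powr (real k - 1 / 4) * exp (- (1 / (16 * T) * s))) =
        space_weight T s * (s ^ k * exp (1 / (16 * T) * s))"
      by (auto simp: space_weight_def indicator_def)
  qed
  finally show "integrable lborel (\<lambda>s. space_weight T s * (s ^ k * exp (1 / (16 * T) * s)))" .
  have "integrable lborel (\<lambda>s. indicator {0<..} s * (s powr (- 1 / 2) * exp (- (1 / (4 * T) * s))))"
    by (rule integrable_powr_exp) (use assms in auto)
  also have "(\<lambda>s. indicator {0<..} s * (s powr (- 1 / 2) * exp (- (1 / (4 * T) * s)))) =
      (\<lambda>s. space_weight T s * space_weight T s)"
  proof
    fix s :: real
    have "exp (- (1 / (4 * T) * s)) = exp (- (1 / (8 * T) * s)) * exp (- (1 / (8 * T) * s))"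
      using assms by (simp add: field_simps flip: exp_add)
    moreover have "s powr (- 1 / 2) = s powr (- 1 / 4) * s powr (- 1 / 4)"
      by (simp flip: powr_add)
    ultimately show "indicator {0<..} s * (s powr (- 1 / 2) * exp (- (1 / (4 * T) * s))) =
        space_weight T s * space_weight T s"
      by (auto simp: space_weight_def indicator_def)
  qed
  finally show "integrable lborel (\<lambda>s. space_weight T s * space_weight T s)" .
qed

lemma set_integrable_power_space_weight:
  fixes F :: "real \<Rightarrow> complex"
  assumes [measurable]: "F \<in> borel_measurable borel" and T: "0 < T"
    and F: "\<And>s. 0 < s \<Longrightarrow> cmod (F s) \<le> M * space_weight T s"
  shows "set_integrable lborel {0<..} (\<lambda>s. s ^ n *\<^sub>R F s)"
  unfolding set_integrable_def
proof (rule Bochner_Integration.integrable_bound[OF integrable_mult_right[OF integrable_space_weight_mult(1)[OF T, of n]]])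
  have "norm (indicator {0<..} s *\<^sub>R (s ^ n *\<^sub>R F s)) \<le>
      norm (M * (space_weight T s * (s ^ n * exp (1 / (16 * T) * s))))" for s
  proof (cases "0 < s")
    case True
    have "s ^ n * cmod (F s) \<le> s ^ n * \<bar>M * space_weight T s\<bar>"
      using True F[OF True] by (intro mult_left_mono) auto
    also have "\<dots> \<le> s ^ n * \<bar>M * space_weight T s\<bar> * exp (1 / (16 * T) * s)"
      using True T mult_left_mono[of 1 "exp (1 / (16 * T) * s)" "s ^ n * \<bar>M * space_weight T s\<bar>"] by simp
    finally show ?thesis using True by (simp add: abs_mult mult_ac)
  qed simp
  then show "AE s in lborel. norm (indicator {0<..} s *\<^sub>R (s ^ n *\<^sub>R F s)) \<le>
      norm (M * (space_weight T s * (s ^ n * exp (1 / (16 * T) * s))))" by simp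
qed measurable

text \<open>The joint integrability behind both exchanges of the integrals in \<open>s\<close> and
  \<open>\<xi>\<close>: for the moments of a profile and for its pairing with the error.\<close>

lemma integrable_heat_kernel_mult:
  fixes f :: "real \<Rightarrow> real \<Rightarrow> complex"
  assumes [measurable]: "case_prod f \<in> borel_measurable (borel \<Otimes>\<^sub>M borel)"
    and g: "integrable lborel (\<lambda>s. space_weight T s * g s)"
    and f: "\<And>s \<xi>. 0 < s \<Longrightarrow> cmod (f s \<xi>) \<le> g s"
  shows "integrable (lborel \<Otimes>\<^sub>M lborel) (\<lambda>(s, \<xi>). heat_kernel T s \<xi> *\<^sub>R f s \<xi>)"
proof (rule Bochner_Integration.integrable_bound)
  show "integrable (lborel \<Otimes>\<^sub>M lborel) (\<lambda>(s, \<xi>). (space_weight T s * g s) * time_weight T \<xi>)"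
    by (rule integrable_mult_pair[OF g integrable_time_weight])
  have "cmod (heat_kernel T s \<xi> *\<^sub>R f s \<xi>) \<le> \<bar>space_weight T s * g s * time_weight T \<xi>\<bar>" for s \<xi>
  proof (cases "0 < s")
    case True
    have "heat_kernel T s \<xi> * cmod (f s \<xi>) \<le> (time_weight T \<xi> * space_weight T s) * g s"
      using True f by (intro mult_mono heat_kernel_le)
        (auto simp: time_weight_nonneg space_weight_nonneg)
    then show ?thesis by (simp add: heat_kernel_nonneg mult_ac)
  qed (simp add: heat_kernel_def)
  then show "AE x in lborel \<Otimes>\<^sub>M lborel. norm (case x of (s, \<xi>) \<Rightarrow> heat_kernel T s \<xi> *\<^sub>R f s \<xi>) \<le>
      norm (case x of (s, \<xi>) \<Rightarrow> (space_weight T s * g s) * time_weight T \<xi>)"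
    by (auto simp: case_prod_unfold)
qed measurable

text \<open>The bound depends on \<open>w\<close> only through \<open>L\<close>, so one majorant
  serves all admissible controls.\<close>

lemma cmod_control_profile_le:
  assumes [measurable]: "w \<in> borel_measurable borel" and w: "\<And>\<xi>. cmod (w \<xi>) \<le> L"
  shows "cmod (control_profile T w s) \<le> L * integral\<^sup>L lborel (time_weight T) * space_weight T s"
proof -
  have "cmod (control_profile T w s) = 1 / pi * cmod (LINT \<xi>|lborel. heat_kernel T s \<xi> *\<^sub>R w \<xi>)"
    by (simp add: control_profile_def)
  also have "\<dots> \<le> 1 * cmod (LINT \<xi>|lborel. heat_kernel T s \<xi> *\<^sub>R w \<xi>)"
    using pi_gt3 by (intro mult_right_mono) auto
  also have "cmod (LINT \<xi>|lborel. heat_kernel T s \<xi> *\<^sub>R w \<xi>) \<le>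
      (LINT \<xi>|lborel. time_weight T \<xi> * (space_weight T s * L))"
  proof (rule Bochner_Integration.integral_norm_bound_integral)
    have le: "cmod (heat_kernel T s \<xi> *\<^sub>R w \<xi>) \<le> time_weight T \<xi> * (space_weight T s * L)" for \<xi>
    proof -
      have "heat_kernel T s \<xi> * cmod (w \<xi>) \<le> (time_weight T \<xi> * space_weight T s) * L"
        using w by (intro mult_mono heat_kernel_le) (auto simp: time_weight_nonneg space_weight_nonneg)
      then show ?thesis by (simp add: heat_kernel_nonneg mult_ac)
    qed
    then show "cmod (heat_kernel T s \<xi> *\<^sub>R w \<xi>) \<le> time_weight T \<xi> * (space_weight T s * L)" for \<xi> .
    show int: "integrable lborel (\<lambda>\<xi>. time_weight T \<xi> * (space_weight T s * L))"
      by (intro integrable_mult_left integrable_time_weight)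
    show "integrable lborel (\<lambda>\<xi>. heat_kernel T s \<xi> *\<^sub>R w \<xi>)"
      by (rule Bochner_Integration.integrable_bound[OF int])
        (auto intro!: AE_I2 order_trans[OF le] simp del: norm_scaleR)
  qed
  also have "\<dots> = integral\<^sup>L lborel (time_weight T) * (space_weight T s * L)" by simp
  finally show ?thesis by (simp add: mult_ac)
qed

text \<open>A Gamma integral of scale \<open>4 * \<xi>\<close>. Moments of the kernel in
  \<open>s\<close> are monomials in \<open>\<xi>\<close>, which is why moments of a state are
  moments in time of its control.\<close>

lemma heat_kernel_moment:
  "has_bochner_integral lborel (\<lambda>s. heat_kernel T s \<xi> * s ^ n)
    (indicator {0<..<T} \<xi> * (2 * 4 ^ n * fact n * \<xi> ^ n))"
proof (cases "0 < \<xi> \<and> \<xi> < T")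
  case True
  have "has_bochner_integral lborel (\<lambda>s. 1 / (2 * \<xi>) * (indicator {0<..} s * (s ^ n * exp (- (s / (4 * \<xi>))))))
      (1 / (2 * \<xi>) * (fact n * (4 * \<xi>) ^ Suc n))"
    using set_integral_power_exp[of "4 * \<xi>" n] True
    by (intro has_bochner_integral_mult_right)
      (simp add: set_lebesgue_integral_def set_integrable_def has_bochner_integral_iff del: power_Suc)
  also have "1 / (2 * \<xi>) * (fact n * (4 * \<xi>) ^ Suc n) = indicator {0<..<T} \<xi> * (2 * 4 ^ n * fact n * \<xi> ^ n)"
    using True by (simp add: field_simps power_mult_distrib)
  also have "(\<lambda>s. 1 / (2 * \<xi>) * (indicator {0<..} s * (s ^ n * exp (- (s / (4 * \<xi>)))))) =
      (\<lambda>s. heat_kernel T s \<xi> * s ^ n)"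
    using True by (auto simp: heat_kernel_def)
  finally show ?thesis .
qed (auto simp: heat_kernel_def indicator_def has_bochner_integral_zero)

lemma control_profile_moment:
  assumes T: "0 < T" and [measurable]: "w \<in> borel_measurable borel" and w: "\<And>\<xi>. cmod (w \<xi>) \<le> L"
  shows "(LINT s:{0<..}|lborel. s ^ n *\<^sub>R control_profile T w s) =
    - (2 / pi * 4 ^ n * fact n) *\<^sub>R (LINT \<xi>:{0<..<T}|lborel. \<xi> ^ n *\<^sub>R w \<xi>)"
proof -
  have L: "0 \<le> L" using w[of 0] norm_ge_zero order_trans by blast
  have int: "integrable (lborel \<Otimes>\<^sub>M lborel) (\<lambda>(s, \<xi>). heat_kernel T s \<xi> *\<^sub>R (s ^ n *\<^sub>R w \<xi>))"
  proof (rule integrable_heat_kernel_mult)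
    \<comment> \<open>The factor \<open>exp (1 / (16 * T) * s)\<close>, at least 1 for
      \<open>s > 0\<close>, only brings the majorant into the form of the integrability
      lemma.\<close>
    show "integrable lborel (\<lambda>s. space_weight T s * (L * (s ^ n * exp (1 / (16 * T) * s))))"
      using integrable_mult_right[OF integrable_space_weight_mult(1)[OF T, of n], of L] by (simp add: mult_ac)
    fix s \<xi> :: real assume "0 < s"
    then have "s ^ n * cmod (w \<xi>) \<le> s ^ n * exp (1 / (16 * T) * s) * L"
      using T w L by (intro mult_mono) auto
    then show "cmod (s ^ n *\<^sub>R w \<xi>) \<le> L * (s ^ n * exp (1 / (16 * T) * s))"
      using \<open>0 < s\<close> by (simp add: mult_ac)
  qed measurable
  have "(LINT s:{0<..}|lborel. s ^ n *\<^sub>R control_profile T w s) =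
      (LINT s|lborel. - (1 / pi) *\<^sub>R (LINT \<xi>|lborel. heat_kernel T s \<xi> *\<^sub>R (s ^ n *\<^sub>R w \<xi>)))"
    unfolding set_lebesgue_integral_def
  proof (intro Bochner_Integration.integral_cong refl)
    fix s :: real
    have "(LINT \<xi>|lborel. heat_kernel T s \<xi> *\<^sub>R (s ^ n *\<^sub>R w \<xi>)) = (LINT \<xi>|lborel. s ^ n *\<^sub>R (heat_kernel T s \<xi> *\<^sub>R w \<xi>))"
      by (simp add: mult.commute)
    also have "\<dots> = s ^ n *\<^sub>R (LINT \<xi>|lborel. heat_kernel T s \<xi> *\<^sub>R w \<xi>)"
      by (rule integral_scaleR_right)
    finally show "indicator {0<..} s *\<^sub>R s ^ n *\<^sub>R control_profile T w s =
        - (1 / pi) *\<^sub>R (LINT \<xi>|lborel. heat_kernel T s \<xi> *\<^sub>R (s ^ n *\<^sub>R w \<xi>))"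
      by (auto simp: control_profile_def indicator_def heat_kernel_def)
  qed
  also have "\<dots> = - (1 / pi) *\<^sub>R (LINT s|lborel. LINT \<xi>|lborel. heat_kernel T s \<xi> *\<^sub>R (s ^ n *\<^sub>R w \<xi>))"
    by (rule integral_scaleR_right)
  also have "(LINT s|lborel. LINT \<xi>|lborel. heat_kernel T s \<xi> *\<^sub>R (s ^ n *\<^sub>R w \<xi>)) =
      (LINT \<xi>|lborel. LINT s|lborel. heat_kernel T s \<xi> *\<^sub>R (s ^ n *\<^sub>R w \<xi>))"
    by (rule lborel_pair.Fubini_integral[OF int, symmetric])
  also have "\<dots> = (LINT \<xi>|lborel. (2 * 4 ^ n * fact n) *\<^sub>R (indicator {0<..<T} \<xi> *\<^sub>R (\<xi> ^ n *\<^sub>R w \<xi>)))"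
  proof (intro Bochner_Integration.integral_cong refl)
    fix \<xi> :: real
    have "(LINT s|lborel. heat_kernel T s \<xi> *\<^sub>R (s ^ n *\<^sub>R w \<xi>)) = (LINT s|lborel. (heat_kernel T s \<xi> * s ^ n) *\<^sub>R w \<xi>)"
      by simp
    also have "\<dots> = (LINT s|lborel. heat_kernel T s \<xi> * s ^ n) *\<^sub>R w \<xi>"
      using heat_kernel_moment[of T \<xi> n]
      by (intro integral_scaleR_left) (auto simp: has_bochner_integral_iff)
    finally show "(LINT s|lborel. heat_kernel T s \<xi> *\<^sub>R (s ^ n *\<^sub>R w \<xi>)) =
        (2 * 4 ^ n * fact n) *\<^sub>R (indicator {0<..<T} \<xi> *\<^sub>R (\<xi> ^ n *\<^sub>R w \<xi>))"
      using has_bochner_integral_integral_eq[OF heat_kernel_moment[of T \<xi> n]] by (simp add: mult_ac)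
  qed
  also have "\<dots> = (2 * 4 ^ n * fact n) *\<^sub>R (LINT \<xi>:{0<..<T}|lborel. \<xi> ^ n *\<^sub>R w \<xi>)"
    unfolding set_lebesgue_integral_def by (rule integral_scaleR_right)
  finally show ?thesis by simp
qed

section \<open>Strong convergence\<close>

lemma moment_convergence:
  fixes G :: "real \<Rightarrow> complex" and w :: "nat \<Rightarrow> real \<Rightarrow> complex"
  assumes T: "0 < T"
    and [measurable]: "G \<in> borel_measurable borel" and w_measurable [measurable]: "\<And>N. w N \<in> borel_measurable borel"
    and G: "\<And>s. 0 < s \<Longrightarrow> cmod (G s) \<le> M * space_weight T s"
    and w: "\<And>N \<xi>. cmod (w N \<xi>) \<le> L"
    and moments: "\<And>n N. n \<le> N \<Longrightarrow> (LINT s:{0<..}|lborel. s ^ n *\<^sub>R G s) =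
      (LINT s:{0<..}|lborel. s ^ n *\<^sub>R control_profile T (w N) s)"
  shows "(\<lambda>N. LINT s:{0<..}|lborel. (cmod (G s - control_profile T (w N) s))\<^sup>2) \<longlonglongrightarrow> 0"
proof -
  let ?H = "\<lambda>N. control_profile T (w N)" and ?q = "space_weight T"
  have [measurable]: "cnj \<in> borel_measurable borel"
    by (intro borel_measurable_continuous_onI continuous_intros)
  define K where "K = L * integral\<^sup>L lborel (time_weight T)"
  define C where "C = M + K"
  \<comment> \<open>The cutoff makes the bound by a multiple of \<open>?q\<close> valid on the whole
    line, including \<open>s \<le> 0\<close>, where \<open>?q\<close> vanishes.\<close>
  define D where "D N s = indicator {0<..} s *\<^sub>R (G s - ?H N s)" for N s
  have H: "cmod (?H N s) \<le> K * ?q s" for N s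
    unfolding K_def by (rule cmod_control_profile_le) (use w in auto)
  have L: "0 \<le> L" using w[of 0 0] norm_ge_zero order_trans by blast
  have D_le: "cmod (D N s) \<le> C * ?q s" for N s
  proof (cases "0 < s")
    case True
    have "cmod (G s - ?H N s) \<le> M * ?q s + K * ?q s"
      using norm_triangle_ineq4[of "G s" "?H N s"] G[OF True] H[of N s] by linarith
    then show ?thesis using True by (simp add: D_def C_def algebra_simps)
  qed (simp add: D_def space_weight_def)
  have int_D: "integrable lborel (\<lambda>s. (C * ?q s) * (\<bar>Q\<bar> * ?q s))" for Q
    using integrable_mult_right[OF integrable_space_weight_mult(2)[OF T], of "C * \<bar>Q\<bar>"] by (simp add: mult_ac)
  \<comment> \<open>The rate \<open>1 / (16 * T)\<close> is half the decay rate of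
    \<open>?q\<close>.\<close>
  interpret vanishing_moments D "\<lambda>s. C * ?q s" "1 / (16 * T)"
  proof
    show "D N \<in> borel_measurable borel" for N unfolding D_def by measurable
    show "integrable lborel (\<lambda>s. C * ?q s * (s ^ k * exp (1 / (16 * T) * s)))" for k
      using integrable_mult_right[OF integrable_space_weight_mult(1)[OF T, of k], of C] by (simp add: mult_ac)
    show "(LINT s|lborel. D N s * of_real (s ^ n)) = 0" if "n \<le> N" for n N
    proof -
      have "(LINT s|lborel. D N s * of_real (s ^ n)) = (LINT s|lborel.
          indicator {0<..} s *\<^sub>R (s ^ n *\<^sub>R G s) - indicator {0<..} s *\<^sub>R (s ^ n *\<^sub>R ?H N s))"
        by (intro Bochner_Integration.integral_cong)
          (auto simp: D_def indicator_def scaleR_conv_of_real algebra_simps)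
      also have "\<dots> = 0"
        using moments[OF that]
        by (subst Bochner_Integration.integral_diff)
           (use set_integrable_power_space_weight[OF _ T G] set_integrable_power_space_weight[OF _ T H]
             in \<open>auto simp: set_lebesgue_integral_def set_integrable_def\<close>)
      finally show ?thesis .
    qed
  qed (use T D_le in \<open>auto simp: space_weight_def\<close>)
  \<comment> \<open>Since \<open>?q\<close> is square integrable, every function bounded by a
    multiple of \<open>?q\<close> is an admissible test function. This includes \<open>G\<close>,
    the profiles, and the kernel at each fixed time.\<close>
  have null: "(\<lambda>N. LINT s|lborel. D N s * \<phi> s) \<longlonglongrightarrow> 0"
    and int: "integrable lborel (\<lambda>s. D N s * \<phi> s)"
    if [measurable]: "\<phi> \<in> borel_measurable borel" and \<phi>: "\<And>s. 0 < s \<Longrightarrow> cmod (\<phi> s) \<le> Q * ?q s" for \<phi> Q N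
  proof -
    have *: "integrable lborel (\<lambda>s. C * ?q s * cmod (\<phi> s))"
    proof (rule Bochner_Integration.integrable_bound[OF int_D[of Q]])
      have "norm (C * ?q s * cmod (\<phi> s)) \<le> norm ((C * ?q s) * (\<bar>Q\<bar> * ?q s))" for s
      proof (cases "0 < s")
        case True
        have "cmod (\<phi> s) \<le> \<bar>Q\<bar> * ?q s"
          using \<phi>[OF True] mult_right_mono[OF abs_ge_self[of Q] space_weight_nonneg[of T s]] by linarith
        then show ?thesis by (simp add: abs_mult mult_left_mono space_weight_nonneg)
      qed (simp add: space_weight_def)
      then show "AE s in lborel. norm (C * ?q s * cmod (\<phi> s)) \<le> norm ((C * ?q s) * (\<bar>Q\<bar> * ?q s))" by simp
    qed measurable
    show "(\<lambda>N. LINT s|lborel. D N s * \<phi> s) \<longlonglongrightarrow> 0"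
      using weakly_null_all[OF _ *] by (simp add: weakly_null_def)
    show "integrable lborel (\<lambda>s. D N s * \<phi> s)" by (rule integrable_D_mult[OF _ *]) simp
  qed
  \<comment> \<open>Up to the factor \<open>- (1 / pi)\<close>, this is the adjoint of the control
    operator applied to \<open>D N\<close>.\<close>
  define P where "P N \<xi> = (LINT s|lborel. D N s * of_real (heat_kernel T s \<xi>))" for N \<xi>
  have kernel_le: "cmod (of_real (heat_kernel T s \<xi>)) \<le> time_weight T \<xi> * ?q s" for s \<xi>
    using heat_kernel_le[of T s \<xi>] by (simp add: heat_kernel_nonneg)
  have P_le: "cmod (P N \<xi>) \<le> time_weight T \<xi> * (LINT s|lborel. C * (?q s * ?q s))" for N \<xi>
  proof -
    have "cmod (P N \<xi>) \<le> (LINT s|lborel. time_weight T \<xi> * (C * (?q s * ?q s)))"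
      unfolding P_def
    proof (rule Bochner_Integration.integral_norm_bound_integral)
      show "integrable lborel (\<lambda>s. D N s * of_real (heat_kernel T s \<xi>))"
        by (rule int[OF _ kernel_le]) simp
      show "integrable lborel (\<lambda>s. time_weight T \<xi> * (C * (?q s * ?q s)))"
        by (intro integrable_mult_right integrable_space_weight_mult T)
      show "cmod (D N s * of_real (heat_kernel T s \<xi>)) \<le> time_weight T \<xi> * (C * (?q s * ?q s))" for s
        using mult_mono[OF D_le[of N s] kernel_le[of s \<xi>]] D_le[of N s]
        by (auto simp: norm_mult mult_ac intro: order_trans[OF norm_ge_zero])
    qed
    then show ?thesis by simp
  qed
  have P_meas [measurable]: "P N \<in> borel_measurable borel" for N
    unfolding P_def by measurable
  have P_int: "integrable lborel (\<lambda>\<xi>. cmod (P N \<xi>))" for N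
    by (rule Bochner_Integration.integrable_bound[OF integrable_mult_left[OF integrable_time_weight[of T]],
          of _ "LINT s|lborel. C * (?q s * ?q s)"])
       (auto intro!: AE_I2 order_trans[OF P_le])
  \<comment> \<open>Pointwise convergence in \<open>\<xi>\<close> is weak convergence tested on the
    kernel; a multiple of \<open>time_weight\<close> dominates.\<close>
  have P_lim: "(\<lambda>N. LINT \<xi>|lborel. cmod (P N \<xi>)) \<longlonglongrightarrow> (LINT \<xi>::real|lborel. 0)"
  proof (rule integral_dominated_convergence[where w = "\<lambda>\<xi>. time_weight T \<xi> * (LINT s|lborel. C * (?q s * ?q s))"])
    show "integrable lborel (\<lambda>\<xi>. time_weight T \<xi> * (LINT s|lborel. C * (?q s * ?q s)))"
      by (intro integrable_mult_left integrable_time_weight)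
    have "(\<lambda>N. P N \<xi>) \<longlonglongrightarrow> 0" for \<xi>
      unfolding P_def by (rule null[OF _ kernel_le]) simp
    then show "AE \<xi> in lborel. (\<lambda>N. cmod (P N \<xi>)) \<longlonglongrightarrow> 0"
      by (intro AE_I2 tendsto_norm_zero)
  qed (use P_le in auto)
  \<comment> \<open>Fubini moves the kernel onto \<open>D N\<close>. The control then enters only
    through its bound \<open>L\<close>, so its dependence on \<open>N\<close> does no harm.\<close>
  have cross: "cmod (LINT s|lborel. D N s * cnj (?H N s)) \<le> L * (LINT \<xi>|lborel. cmod (P N \<xi>))" for N
  proof -
    have fub: "integrable (lborel \<Otimes>\<^sub>M lborel) (\<lambda>(s, \<xi>). heat_kernel T s \<xi> *\<^sub>R (D N s * cnj (w N \<xi>)))"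
    proof (rule integrable_heat_kernel_mult)
      show "integrable lborel (\<lambda>s. ?q s * ((C * ?q s) * L))"
        using int_D[of L] L by (simp add: mult_ac)
      show "cmod (D N s * cnj (w N \<xi>)) \<le> (C * ?q s) * L" for s \<xi>
        using mult_mono[OF D_le[of N s] w[of N \<xi>]] D_le[of N s]
        by (auto simp: norm_mult intro: order_trans[OF norm_ge_zero])
    qed measurable
    have "(LINT s|lborel. D N s * cnj (?H N s)) =
        (LINT s|lborel. - (1 / pi) *\<^sub>R (LINT \<xi>|lborel. heat_kernel T s \<xi> *\<^sub>R (D N s * cnj (w N \<xi>))))"
    proof (intro Bochner_Integration.integral_cong refl)
      fix s :: real
      have "(LINT \<xi>|lborel. heat_kernel T s \<xi> *\<^sub>R cnj (w N \<xi>)) = (LINT \<xi>|lborel. cnj (heat_kernel T s \<xi> *\<^sub>R w N \<xi>))"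
        by (simp add: scaleR_conv_of_real del: Bochner_Integration.integral_cnj)
      also have "\<dots> = cnj (LINT \<xi>|lborel. heat_kernel T s \<xi> *\<^sub>R w N \<xi>)" by (rule Bochner_Integration.integral_cnj)
      finally have "cnj (LINT \<xi>|lborel. heat_kernel T s \<xi> *\<^sub>R w N \<xi>) = (LINT \<xi>|lborel. heat_kernel T s \<xi> *\<^sub>R cnj (w N \<xi>))" ..
      then have "D N s * cnj (?H N s) = - (1 / pi) *\<^sub>R (D N s * (LINT \<xi>|lborel. heat_kernel T s \<xi> *\<^sub>R cnj (w N \<xi>)))"
        by (simp add: control_profile_def scaleR_conv_of_real)
      also have "D N s * (LINT \<xi>|lborel. heat_kernel T s \<xi> *\<^sub>R cnj (w N \<xi>)) =
          (LINT \<xi>|lborel. D N s * (heat_kernel T s \<xi> *\<^sub>R cnj (w N \<xi>)))"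
        by (rule integral_mult_right_zero[symmetric])
      finally show "D N s * cnj (?H N s) = - (1 / pi) *\<^sub>R (LINT \<xi>|lborel. heat_kernel T s \<xi> *\<^sub>R (D N s * cnj (w N \<xi>)))"
        by (simp only: mult_scaleR_right)
    qed
    also have "\<dots> = - (1 / pi) *\<^sub>R (LINT s|lborel. LINT \<xi>|lborel. heat_kernel T s \<xi> *\<^sub>R (D N s * cnj (w N \<xi>)))"
      by (rule integral_scaleR_right)
    also have "(LINT s|lborel. LINT \<xi>|lborel. heat_kernel T s \<xi> *\<^sub>R (D N s * cnj (w N \<xi>))) =
        (LINT \<xi>|lborel. LINT s|lborel. heat_kernel T s \<xi> *\<^sub>R (D N s * cnj (w N \<xi>)))"
      by (rule lborel_pair.Fubini_integral[OF fub, symmetric])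
    also have "\<dots> = (LINT \<xi>|lborel. P N \<xi> * cnj (w N \<xi>))"
    proof (intro Bochner_Integration.integral_cong refl)
      fix \<xi> :: real
      have "(LINT s|lborel. heat_kernel T s \<xi> *\<^sub>R (D N s * cnj (w N \<xi>))) =
          (LINT s|lborel. (D N s * of_real (heat_kernel T s \<xi>)) * cnj (w N \<xi>))"
        by (simp add: scaleR_conv_of_real mult_ac)
      then show "(LINT s|lborel. heat_kernel T s \<xi> *\<^sub>R (D N s * cnj (w N \<xi>))) = P N \<xi> * cnj (w N \<xi>)"
        unfolding P_def by simp
    qed
    finally have "cmod (LINT s|lborel. D N s * cnj (?H N s)) = 1 / pi * cmod (LINT \<xi>|lborel. P N \<xi> * cnj (w N \<xi>))"
      by simp
    also have "\<dots> \<le> 1 * cmod (LINT \<xi>|lborel. P N \<xi> * cnj (w N \<xi>))"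
      using pi_gt3 by (intro mult_right_mono) auto
    also have "cmod (LINT \<xi>|lborel. P N \<xi> * cnj (w N \<xi>)) \<le> (LINT \<xi>|lborel. cmod (P N \<xi>) * L)"
    proof (rule Bochner_Integration.integral_norm_bound_integral)
      show *: "integrable lborel (\<lambda>\<xi>. cmod (P N \<xi>) * L)" by (intro integrable_mult_left P_int)
      show **: "cmod (P N \<xi> * cnj (w N \<xi>)) \<le> cmod (P N \<xi>) * L" for \<xi>
        using w by (simp add: norm_mult mult_left_mono)
      show "integrable lborel (\<lambda>\<xi>. P N \<xi> * cnj (w N \<xi>))"
        by (rule Bochner_Integration.integrable_bound[OF *]) (auto intro!: AE_I2 order_trans[OF **])
    qed
    finally show ?thesis by (simp add: mult.commute)
  qed
  have "(\<lambda>N. cmod (LINT s|lborel. D N s * cnj (G s)) + L * (LINT \<xi>|lborel. cmod (P N \<xi>))) \<longlonglongrightarrow> 0 + L * 0"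
  proof (intro tendsto_add tendsto_mult tendsto_const tendsto_norm_zero)
    show "(\<lambda>N. LINT s|lborel. D N s * cnj (G s)) \<longlonglongrightarrow> 0"
      by (rule null[where Q = M]) (measurable, simp add: G)
    show "(\<lambda>N. LINT \<xi>|lborel. cmod (P N \<xi>)) \<longlonglongrightarrow> 0" using P_lim by simp
  qed
  then have lim: "(\<lambda>N. cmod (LINT s|lborel. D N s * cnj (G s)) + L * (LINT \<xi>|lborel. cmod (P N \<xi>))) \<longlonglongrightarrow> 0"
    by simp
  show ?thesis
  proof (rule Lim_null_comparison[OF _ lim], intro always_eventually allI)
    fix N
    \<comment> \<open>The real integral is read as a complex one, so that
      \<open>D N s * cnj (D N s)\<close> can be split into the terms with \<open>G\<close> and with
      the profile.\<close>
    have "complex_of_real (LINT s:{0<..}|lborel. (cmod (G s - ?H N s))\<^sup>2) =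
        (LINT s|lborel. of_real (indicator {0<..} s * (cmod (G s - ?H N s))\<^sup>2))"
      by (simp add: set_lebesgue_integral_def del: of_real_mult)
    also have "\<dots> = (LINT s|lborel. D N s * cnj (G s) - D N s * cnj (?H N s))"
      by (intro Bochner_Integration.integral_cong refl)
         (auto simp: D_def indicator_def complex_norm_square algebra_simps simp del: of_real_power)
    also have "\<dots> = (LINT s|lborel. D N s * cnj (G s)) - (LINT s|lborel. D N s * cnj (?H N s))"
    proof (rule Bochner_Integration.integral_diff)
      show "integrable lborel (\<lambda>s. D N s * cnj (G s))"
        by (rule int[where Q = M]) (measurable, simp add: G)
      show "integrable lborel (\<lambda>s. D N s * cnj (?H N s))"
        by (rule int[where Q = K]) (measurable, simp add: H)
    qed
    finally have "\<bar>LINT s:{0<..}|lborel. (cmod (G s - ?H N s))\<^sup>2\<bar> =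
        cmod ((LINT s|lborel. D N s * cnj (G s)) - (LINT s|lborel. D N s * cnj (?H N s)))"
      by (subst norm_of_real[symmetric, where 'a = complex]) (rule arg_cong[where f = cmod])
    also have "\<dots> \<le> cmod (LINT s|lborel. D N s * cnj (G s)) + L * (LINT \<xi>|lborel. cmod (P N \<xi>))"
      using norm_triangle_ineq4[of "LINT s|lborel. D N s * cnj (G s)" "LINT s|lborel. D N s * cnj (?H N s)"] cross[of N]
      by linarith
    finally show "norm (LINT s:{0<..}|lborel. (cmod (G s - ?H N s))\<^sup>2) \<le>
        cmod (LINT s|lborel. D N s * cnj (G s)) + L * (LINT \<xi>|lborel. cmod (P N \<xi>))"
      by simp
  qed
qed

section \<open>Representatives and the reachable set\<close>

text \<open>Each preimage under \<open>f\<close> differs from a Borel set by a null set, and the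
  completed measure contains such sets.\<close>

lemma borel_measurable_lebesgue_AE:
  fixes f g :: "'a::euclidean_space \<Rightarrow> 'b::topological_space"
  assumes g: "g \<in> borel_measurable borel" and ae: "AE x in lborel. f x = g x"
  shows "f \<in> borel_measurable lebesgue"
proof (rule measurableI)
  fix A :: "'b set" assume A: "A \<in> sets borel"
  show "f -` A \<inter> space lebesgue \<in> sets lebesgue"
  proof (rule completion.in_sets_AE)
    show "AE x in lebesgue. x \<in> g -` A \<longleftrightarrow> x \<in> f -` A \<inter> space lebesgue"
      using AE_completion[OF ae] by eventually_elim auto
    show "g -` A \<in> sets lebesgue" using measurable_sets[OF g A] by simp
  qed simp
qed simp

lemma integral_lebesgue_AE:
  fixes f g :: "'a::euclidean_space \<Rightarrow> 'b::{banach, second_countable_topology}"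
  assumes g: "g \<in> borel_measurable borel" and ae: "AE x in lborel. f x = g x"
  shows "integral\<^sup>L lebesgue f = integral\<^sup>L lborel g"
proof -
  have "integral\<^sup>L lebesgue f = integral\<^sup>L lebesgue g"
    by (intro integral_cong_AE borel_measurable_lebesgue_AE[OF assms] measurable_completion)
       (use g AE_completion[OF ae] in auto)
  then show ?thesis using g by (simp add: integral_completion)
qed

lemma borel_representative:
  fixes f :: "'a::euclidean_space \<Rightarrow> complex"
  assumes f: "f \<in> borel_measurable lebesgue"
  obtains g where "g \<in> borel_measurable borel" "AE x in lborel. f x = g x"
proof -
  have "(\<lambda>x. Re (f x)) \<in> borel_measurable lebesgue" and im: "(\<lambda>x. Im (f x)) \<in> borel_measurable lebesgue"
    using f by (simp_all add: borel_measurable_complex_iff)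
  from completion_ex_borel_measurable_real[OF this(1)] completion_ex_borel_measurable_real[OF im]
  obtain r i where "r \<in> borel_measurable lborel" "i \<in> borel_measurable lborel"
    and r: "AE x in lborel. Re (f x) = r x" and i: "AE x in lborel. Im (f x) = i x"
    by blast
  then have [measurable]: "r \<in> borel_measurable borel" "i \<in> borel_measurable borel" by simp_all
  show ?thesis
  proof
    show "(\<lambda>x. Complex (r x) (i x)) \<in> borel_measurable borel"
      by (simp add: borel_measurable_complex_iff)
    show "AE x in lborel. f x = Complex (r x) (i x)"
      using r i by eventually_elim (simp add: complex_eq_iff)
  qed
qed

text \<open>\<open>P\<close> may be nonmeasurable, so a Borel null set containing its exceptions is
  reflected instead.\<close>

lemma AE_lborel_reflect:
  assumes "AE t in lborel. P (t::real)"
  shows "AE \<xi> in lborel. P (T - \<xi>)"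
proof -
  obtain N where N: "\<And>t. t \<notin> N \<Longrightarrow> P t" "N \<in> null_sets lborel"
    using AE_E3[OF assms] by auto
  then have [measurable]: "N \<in> sets borel" by auto
  have "AE t in lborel. t \<notin> N" using N(2) by (rule AE_not_in)
  then have "AE \<xi> in lborel. T + (- 1) * \<xi> \<notin> N"
    by (intro AE_borel_affine) auto
  then show ?thesis by eventually_elim (use N(1) in simp)
qed

lemma distr_lborel_norm_power2:
  obtains c where "0 \<le> c"
    "distr (density lborel (\<lambda>x :: real \<times> real. ennreal 1)) borel (\<lambda>x. (norm x)\<^sup>2) =
       density lborel (\<lambda>s. ennreal (c * s ^ 0 * indicator {0<..} s))"
  by (rule distr_norm_power2_homogeneous[of "\<lambda>x. 1" 0]) auto

text \<open>The image of planar Lebesgue measure under the squared norm has a density supported on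
  \<open>s > 0\<close>, so preimages of null sets are null. The value \<open>s = 0\<close> concerns
  only the origin.\<close>

lemma AE_norm_power2:
  assumes "AE s in lborel. 0 < s \<longrightarrow> P s"
  shows "AE x in (lborel :: (real \<times> real) measure). P ((norm x)\<^sup>2)"
proof -
  obtain c where distr: "distr (density lborel (\<lambda>x :: real \<times> real. ennreal 1)) borel (\<lambda>x. (norm x)\<^sup>2) =
       density lborel (\<lambda>s. ennreal (c * s ^ 0 * indicator {0<..} s))"
    by (rule distr_lborel_norm_power2)
  obtain N where N: "\<And>s. s \<notin> N \<Longrightarrow> 0 < s \<longrightarrow> P s" "N \<in> null_sets lborel"
    using AE_E3[OF assms] by auto
  then have [measurable]: "N \<in> sets borel" by auto
  have "AE s in density lborel (\<lambda>s. ennreal (c * s ^ 0 * indicator {0<..} s)). s \<notin> N"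
    using AE_not_in[OF N(2)] by (subst AE_density) auto
  then have "AE x in (lborel :: (real \<times> real) measure). (norm x)\<^sup>2 \<notin> N"
    unfolding distr[symmetric] by (subst (asm) AE_distr_iff) (auto simp: AE_density)
  moreover have "AE x in lborel. x \<noteq> (0 :: real \<times> real)" by (rule AE_lborel_singleton)
  ultimately show ?thesis
    by eventually_elim (use N(1) in simp)
qed

text \<open>With \<open>q = z powr (1 / 4)\<close>, it follows from
  \<open>1 + q ^ 4 \<le> (1 + q) ^ 4\<close> and \<open>ln (1 + q) \<le> q\<close>. The power
  matches the singularity of \<open>space_weight\<close>.\<close>

lemma ln_one_plus_le_powr:
  assumes "0 < (z::real)"
  shows "ln (1 + z) \<le> 4 * z powr (1 / 4)"
proof -
  define q where "q = z powr (1 / 4)"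
  have q: "0 < q" using assms by (simp add: q_def)
  have "z = q ^ 4" using assms by (simp add: q_def powr_powr flip: powr_realpow)
  then have "1 + z \<le> (1 + q) ^ 4" using q by (simp add: power4_eq_xxxx algebra_simps)
  then have "ln (1 + z) \<le> ln ((1 + q) ^ 4)" using assms q by simp
  also have "\<dots> = 4 * ln (1 + q)" using q by (simp add: ln_realpow)
  also have "\<dots> \<le> 4 * q" using ln_add_one_self_le_self[of q] q by simp
  finally show ?thesis by (simp add: q_def)
qed

text \<open>This places the target under the same weight as the control profiles: the logarithm is
  bounded by a power and the Gaussian rate is halved.\<close>

lemma target_bound_le_space_weight:
  assumes T: "0 < T" and L: "0 < L" and s: "0 < (s::real)"
  shows "L / (2 * pi) * exp (- s / (4 * T)) * ln (1 + 4 * T / s) \<le>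
    (L / (2 * pi) * (4 * (4 * T) powr (1 / 4))) * space_weight T s"
proof -
  have "L / (2 * pi) * exp (- s / (4 * T)) * ln (1 + 4 * T / s) \<le>
      L / (2 * pi) * exp (- (1 / (8 * T) * s)) * (4 * (4 * T / s) powr (1 / 4))"
  proof (intro mult_mono)
    have "s / (8 * T) \<le> s / (4 * T)" using T s by (intro divide_left_mono) auto
    then show "exp (- s / (4 * T)) \<le> exp (- (1 / (8 * T) * s))" by simp
    have z: "0 < 4 * T / s" using T s by simp
    show "ln (1 + 4 * T / s) \<le> 4 * (4 * T / s) powr (1 / 4)" by (rule ln_one_plus_le_powr[OF z])
    show "0 \<le> ln (1 + 4 * T / s)" using z by simp
  qed (use L in auto)
  also have "(4 * T / s) powr (1 / 4) = (4 * T) powr (1 / 4) * s powr (- 1 / 4)"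
    using powr_divide[of "4 * T" s "1 / 4"] powr_minus_divide[of s "1 / 4"] by simp
  finally show ?thesis using s by (simp add: space_weight_def mult_ac)
qed

section \<open>Square integrability of radial functions\<close>

lemma L2_space_UNIV_iff:
  "f \<in> L2_space UNIV \<longleftrightarrow> f \<in> borel_measurable lebesgue \<and> integrable lebesgue (\<lambda>x. (cmod (f x))\<^sup>2)"
  by (simp add: L2_space_def lebesgue_on_UNIV_eq)

lemma L2_space_add:
  assumes f: "f \<in> L2_space UNIV" and g: "g \<in> L2_space UNIV"
  shows "(\<lambda>x. f x + g x) \<in> L2_space UNIV"
proof -
  note fg = f[unfolded L2_space_UNIV_iff] g[unfolded L2_space_UNIV_iff]
  then have [measurable]: "f \<in> borel_measurable lebesgue" "g \<in> borel_measurable lebesgue" by auto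
  have "integrable lebesgue (\<lambda>x. (cmod (f x + g x))\<^sup>2)"
  proof (rule Bochner_Integration.integrable_bound)
    show "integrable lebesgue (\<lambda>x. 2 * (cmod (f x))\<^sup>2 + 2 * (cmod (g x))\<^sup>2)" using fg by simp
    have "(cmod (f x + g x))\<^sup>2 \<le> 2 * (cmod (f x))\<^sup>2 + 2 * (cmod (g x))\<^sup>2" for x
    proof -
      have "(cmod (f x + g x))\<^sup>2 \<le> (cmod (f x) + cmod (g x))\<^sup>2"
        by (intro power_mono norm_triangle_ineq) auto
      also have "\<dots> \<le> 2 * (cmod (f x))\<^sup>2 + 2 * (cmod (g x))\<^sup>2"
        using zero_le_power2[of "cmod (f x) - cmod (g x)"] by (simp add: power2_eq_square algebra_simps)
      finally show ?thesis .
    qed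
    then show "AE x in lebesgue. norm ((cmod (f x + g x))\<^sup>2) \<le> norm (2 * (cmod (f x))\<^sup>2 + 2 * (cmod (g x))\<^sup>2)"
      by (auto simp: add_nonneg_nonneg)
  qed measurable
  moreover have "(\<lambda>x. f x + g x) \<in> borel_measurable lebesgue" by measurable
  ultimately show ?thesis unfolding L2_space_UNIV_iff by blast
qed

lemma radial_L2_space:
  fixes F :: "real \<Rightarrow> complex"
  assumes [measurable]: "F \<in> borel_measurable borel" and T: "0 < T"
    and F: "\<And>s. 0 < s \<Longrightarrow> cmod (F s) \<le> M * space_weight T s"
  shows "(\<lambda>x :: real \<times> real. F ((norm x)\<^sup>2)) \<in> L2_space UNIV"
proof -
  obtain c where c: "0 \<le> c" and
    distr: "distr (density lborel (\<lambda>x :: real \<times> real. ennreal 1)) borel (\<lambda>x. (norm x)\<^sup>2) =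
       density lborel (\<lambda>s. ennreal (c * s ^ 0 * indicator {0<..} s))"
    by (rule distr_lborel_norm_power2)
  have "integrable lborel (\<lambda>s. indicator {0<..} s *\<^sub>R (s ^ 0 *\<^sub>R (cmod (F s))\<^sup>2))"
  proof (rule Bochner_Integration.integrable_bound[OF integrable_mult_right[OF integrable_space_weight_mult(2)[OF T]]])
    have "(cmod (F s))\<^sup>2 \<le> \<bar>M\<^sup>2 * (space_weight T s * space_weight T s)\<bar>" if "0 < s" for s
      using power_mono[OF F[OF that], of 2] by (simp add: power2_eq_square mult_ac)
    then show "AE s in lborel. norm (indicator {0<..} s *\<^sub>R (s ^ 0 *\<^sub>R (cmod (F s))\<^sup>2)) \<le>
        norm (M\<^sup>2 * (space_weight T s * space_weight T s))"
      by (intro AE_I2) (auto simp: indicator_def)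
  qed measurable
  then have "integrable lborel (\<lambda>x :: real \<times> real. 1 *\<^sub>R (cmod (F ((norm x)\<^sup>2)))\<^sup>2)"
    by (intro integral_homogeneous_radial(2)[OF _ _ _ c distr]) (auto simp: set_integrable_def)
  moreover have "(\<lambda>x :: real \<times> real. F ((norm x)\<^sup>2)) \<in> borel_measurable lborel" by measurable
  ultimately show ?thesis
    by (auto simp: L2_space_UNIV_iff integrable_completion intro: measurable_completion)
qed

text \<open>The planar norm is proportional to the norm of the profile on the half line, with a
  factor independent of \<open>F\<close>; this carries convergence to 0 over to the plane.\<close>

lemma L2_norm_radial:
  obtains c where "\<And>F. F \<in> borel_measurable borel \<Longrightarrow>
    L2_norm (\<lambda>x. F ((norm x)\<^sup>2)) = sqrt (c * (LINT s:{0<..}|lborel. (cmod (F s))\<^sup>2))"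
proof -
  obtain c where c: "0 \<le> c" and
    distr: "distr (density lborel (\<lambda>x :: real \<times> real. ennreal 1)) borel (\<lambda>x. (norm x)\<^sup>2) =
       density lborel (\<lambda>s. ennreal (c * s ^ 0 * indicator {0<..} s))"
    by (rule distr_lborel_norm_power2)
  show ?thesis
  proof (rule that)
    fix F :: "real \<Rightarrow> complex" assume [measurable]: "F \<in> borel_measurable borel"
    have "(LINT x|lebesgue. (cmod (F ((norm (x :: real \<times> real))\<^sup>2)))\<^sup>2) =
        (LINT x|lborel. 1 *\<^sub>R (cmod (F ((norm (x :: real \<times> real))\<^sup>2)))\<^sup>2)"
      by (simp add: integral_completion)
    also have "\<dots> = c *\<^sub>R (LINT s:{0<..}|lborel. s ^ 0 *\<^sub>R (cmod (F s))\<^sup>2)"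
      by (rule integral_homogeneous_radial(1)[OF _ _ _ c distr]) auto
    finally show "L2_norm (\<lambda>x. F ((norm x)\<^sup>2)) = sqrt (c * (LINT s:{0<..}|lborel. (cmod (F s))\<^sup>2))"
      by (simp add: L2_norm_def)
  qed
qed

text \<open>The passage from an essentially bounded, Lebesgue measurable control to a Borel function
  of reversed time that is bounded at every point. Values above \<open>L\<close> occur only on a
  null set of the time interval and are replaced by 0.\<close>

lemma control_representative:
  assumes L: "0 < L" and u: "u \<in> Linf_space T" "Linf_norm T u \<le> ereal L"
  obtains w where "w \<in> borel_measurable borel" "\<And>\<xi>. cmod (w \<xi>) \<le> L"
    "AE \<xi> in lborel. 0 < \<xi> \<and> \<xi> < T \<longrightarrow> u (T - \<xi>) = w \<xi>"
proof -
  have "(\<lambda>t. indicator {0<..<T} t *\<^sub>R u t) \<in> borel_measurable lebesgue"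
    using u(1) by (simp add: Linf_space_def borel_measurable_restrict_space_iff)
  then obtain v where [measurable]: "v \<in> borel_measurable borel"
    and v: "AE t in lborel. indicator {0<..<T} t *\<^sub>R u t = v t"
    by (rule borel_representative)
  have "AE t in lebesgue_on {0<..<T}. ereal (cmod (u t)) \<le> Linf_norm T u"
    unfolding Linf_norm_def by (rule esssup_AE)
  then have "AE t in lebesgue_on {0<..<T}. cmod (u t) \<le> L"
  proof eventually_elim
    case (elim t)
    from order_trans[OF this u(2)] show ?case by simp
  qed
  then have "AE t in lborel. t \<in> {0<..<T} \<longrightarrow> cmod (u t) \<le> L"
    by (simp add: AE_restrict_space_iff AE_completion_iff)
  with v have "AE t in lborel. 0 < t \<and> t < T \<longrightarrow> u t = v t \<and> cmod (v t) \<le> L"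
    by eventually_elim auto
  then have refl: "AE \<xi> in lborel. 0 < T - \<xi> \<and> T - \<xi> < T \<longrightarrow> u (T - \<xi>) = v (T - \<xi>) \<and> cmod (v (T - \<xi>)) \<le> L"
    by (rule AE_lborel_reflect)
  show ?thesis
  proof
    show "(\<lambda>\<xi>. if cmod (v (T - \<xi>)) \<le> L then v (T - \<xi>) else 0) \<in> borel_measurable borel" by measurable
    show "cmod (if cmod (v (T - \<xi>)) \<le> L then v (T - \<xi>) else 0) \<le> L" for \<xi> using L by auto
    show "AE \<xi> in lborel. 0 < \<xi> \<and> \<xi> < T \<longrightarrow> u (T - \<xi>) = (if cmod (v (T - \<xi>)) \<le> L then v (T - \<xi>) else 0)"
      using refl by eventually_elim auto
  qed
qed

text \<open>The way back from Borel functions of reversed time to admissible controls. The origin is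
  excluded because \<open>heat_kernel\<close> is cut off at \<open>s = 0\<close>.\<close>

lemma reflected_control:
  assumes [measurable]: "w \<in> borel_measurable borel" and w: "\<And>\<xi>. cmod (w \<xi>) \<le> L"
  shows "(\<lambda>t. w (T - t)) \<in> Linf_space T" "Linf_norm T (\<lambda>t. w (T - t)) \<le> ereal L"
    "x \<noteq> 0 \<Longrightarrow> control_state (\<lambda>t. w (T - t)) T x = control_profile T w ((norm x)\<^sup>2)"
proof -
  have wT: "(\<lambda>t. w (T - t)) \<in> borel_measurable lebesgue"
    by (intro measurable_completion) measurable
  then have wT': "(\<lambda>t. w (T - t)) \<in> borel_measurable (lebesgue_on {0<..<T})"
    by (rule measurable_restrict_space1)
  then have "(\<lambda>t. ereal (cmod (w (T - t)))) \<in> borel_measurable (lebesgue_on {0<..<T})" by measurable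
  then show le: "Linf_norm T (\<lambda>t. w (T - t)) \<le> ereal L"
    unfolding Linf_norm_def by (rule esssup_I) (use w in auto)
  then have "Linf_norm T (\<lambda>t. w (T - t)) < \<infinity>" by (rule order_le_less_trans) simp
  then show "(\<lambda>t. w (T - t)) \<in> Linf_space T" using wT' unfolding Linf_space_def by blast
  assume "x \<noteq> 0"
  then have eq: "indicator {0<..<T} \<xi> *\<^sub>R (1 / (2 * \<xi>) * exp (- (norm x)\<^sup>2 / (4 * \<xi>))) *\<^sub>R w (T - (T - \<xi>)) =
      heat_kernel T ((norm x)\<^sup>2) \<xi> *\<^sub>R w \<xi>" for \<xi>
    by (simp add: heat_kernel_def)
  show "control_state (\<lambda>t. w (T - t)) T x = control_profile T w ((norm x)\<^sup>2)"
    unfolding control_state_def control_profile_def set_lebesgue_integral_def eq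
    by (subst integral_completion) auto
qed

text \<open>Almost every horizontal section of a planar null set is null, so for almost every
  \<open>y\<close> the inner integral may be computed with the Borel profile. The outer integral
  ignores the other \<open>y\<close>.\<close>

lemma lebesgue_quadrant_moment:
  fixes f :: "real \<times> real \<Rightarrow> complex" and G :: "real \<Rightarrow> complex"
  assumes [measurable]: "G \<in> borel_measurable borel"
    and int: "set_integrable lborel {0<..} (\<lambda>s. s ^ n *\<^sub>R G s)"
    and f: "AE x in lborel. f x = G ((norm x)\<^sup>2)"
  shows "(LINT y:{0<..}|lebesgue. LINT x:{0<..}|lebesgue. x ^ (2 * n) *\<^sub>R f (x, y)) =
    (pi / 4 * (fact (2 * n) / (4 ^ n * (fact n)\<^sup>2))) *\<^sub>R (LINT s:{0<..}|lborel. s ^ n *\<^sub>R G s)"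
proof -
  obtain N where N: "\<And>x. x \<notin> N \<Longrightarrow> f x = G ((norm x)\<^sup>2)" "N \<in> null_sets (lborel :: (real \<times> real) measure)"
    using AE_E3[OF f] by auto
  have [measurable]: "N \<in> sets (borel \<Otimes>\<^sub>M borel)" using N(2) unfolding borel_prod by auto
  have "AE z in lborel \<Otimes>\<^sub>M lborel. z \<notin> N" unfolding lborel_prod by (rule AE_not_in[OF N(2)])
  then have "AE x in lborel. AE y in lborel. (x, y) \<notin> N" by (rule lborel_pair.AE_pair)
  then have ae: "AE y in lborel. AE x in lborel. (x, y) \<notin> N"
    by (subst (asm) lborel_pair.AE_commute) measurable
  have inner: "AE y in lborel. (LINT x:{0<..}|lebesgue. x ^ (2 * n) *\<^sub>R f (x, y)) =
      (LINT x:{0<..}|lborel. x ^ (2 * n) *\<^sub>R G (x\<^sup>2 + y\<^sup>2))"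
    using ae
  proof eventually_elim
    case (elim y)
    have "AE x in lborel. indicator {0<..} x *\<^sub>R (x ^ (2 * n) *\<^sub>R f (x, y)) =
        indicator {0<..} x *\<^sub>R (x ^ (2 * n) *\<^sub>R G (x\<^sup>2 + y\<^sup>2))"
      using elim by eventually_elim (simp add: N(1) norm_prod_power2)
    then show ?case
      unfolding set_lebesgue_integral_def by (intro integral_lebesgue_AE) auto
  qed
  have "(LINT y:{0<..}|lebesgue. LINT x:{0<..}|lebesgue. x ^ (2 * n) *\<^sub>R f (x, y)) =
      (LINT y:{0<..}|lborel. LINT x:{0<..}|lborel. x ^ (2 * n) *\<^sub>R G (x\<^sup>2 + y\<^sup>2))"
    unfolding set_lebesgue_integral_def[of _ _ "\<lambda>y. set_lebesgue_integral _ _ (_ y)"]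
  proof (rule integral_lebesgue_AE)
    show "AE y in lborel. indicator {0<..} y *\<^sub>R (LINT x:{0<..}|lebesgue. x ^ (2 * n) *\<^sub>R f (x, y)) =
        indicator {0<..} y *\<^sub>R (LINT x:{0<..}|lborel. x ^ (2 * n) *\<^sub>R G (x\<^sup>2 + y\<^sup>2))"
      using inner by eventually_elim simp
    show "(\<lambda>y. indicator {0<..} y *\<^sub>R (LINT x:{0<..}|lborel. x ^ (2 * n) *\<^sub>R G (x\<^sup>2 + y\<^sup>2))) \<in> borel_measurable borel"
      unfolding set_lebesgue_integral_def by measurable
  qed
  also have "\<dots> = (pi / 4 * (fact (2 * n) / (4 ^ n * (fact n)\<^sup>2))) *\<^sub>R (LINT s:{0<..}|lborel. s ^ n *\<^sub>R G s)"
    by (rule quadrant_moment) (use int in auto)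
  finally show ?thesis .
qed

text \<open>The profile is extended by 0 from \<open>{0<..}\<close> and modified on a null set; the
  modification stays invisible in the plane by \<open>AE_norm_power2\<close>.\<close>

lemma radial_L2_borel_profile:
  assumes "f \<in> radial_L2"
  obtains g where "g \<in> borel_measurable borel" "AE x in lborel. f x = g ((norm x)\<^sup>2)"
proof -
  obtain h where h: "h \<in> L2_space {0<..}" and f: "AE x in lebesgue. f x = h ((norm x)\<^sup>2)"
    using assms by (auto simp: radial_L2_def)
  have "(\<lambda>s. indicator {0<..} s *\<^sub>R h s) \<in> borel_measurable lebesgue"
    using h by (simp add: L2_space_def borel_measurable_restrict_space_iff)
  then obtain g where g: "g \<in> borel_measurable borel" "AE s in lborel. indicator {0<..} s *\<^sub>R h s = g s"
    by (rule borel_representative)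
  have "AE s in lborel. 0 < s \<longrightarrow> h s = g s" using g(2) by eventually_elim auto
  then have "AE x in (lborel :: (real \<times> real) measure). h ((norm x)\<^sup>2) = g ((norm x)\<^sup>2)"
    by (rule AE_norm_power2)
  moreover have "AE x in lborel. f x = h ((norm x)\<^sup>2)" using f by (simp add: AE_completion_iff)
  ultimately have "AE x in lborel. f x = g ((norm x)\<^sup>2)" by eventually_elim simp
  with g(1) show ?thesis by (rule that)
qed

section \<open>Approximation of the target by reachable states\<close>

theorem theorem3p11:
  fixes L T :: real
    and W0 WT W0T :: "real \<times> real \<Rightarrow> complex"
    and \<omega> :: "nat \<Rightarrow> complex"
  assumes "L > 0" and "T > 0"
    and "W0 \<in> Hhat0" and "WT \<in> Hhat0"
    and W0T_eq: "W0T = (\<lambda>x. WT x - free_state W0 T x)"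
    and "W0T \<in> radial_L2"
    and bound: "AE x in lebesgue. x \<noteq> 0 \<longrightarrow>
      cmod (W0T x) \<le> L / (2 * pi) * exp (- (norm x)\<^sup>2 / (4 * T)) * ln (1 + 4 * T / (norm x)\<^sup>2)"
    and omega_eq: "\<And>n. \<omega> n = (- 2 * (fact n / fact (2 * n))) *\<^sub>R
      (LINT x2:{0<..}|lebesgue. (LINT x1:{0<..}|lebesgue. x1 ^ (2 * n) *\<^sub>R W0T (x1, x2)))"
    and moments: "\<And>N::nat. \<exists>u\<in>Linf_space T. Linf_norm T u \<le> ereal L \<and>
      (\<forall>n\<le>N. (LINT \<xi>:{0<..<T}|lebesgue. \<xi> ^ n *\<^sub>R u (T - \<xi>)) = \<omega> n)"
  shows "WT \<in> Hhat0_topology closure_of (reachable_set L T W0)"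
proof -
  define M where "M = L / (2 * pi) * (4 * (4 * T) powr (1 / 4))"
  obtain g where [measurable]: "g \<in> borel_measurable borel" and g: "AE x in lborel. W0T x = g ((norm x)\<^sup>2)"
    using radial_L2_borel_profile[OF \<open>W0T \<in> radial_L2\<close>] .
  \<comment> \<open>The truncation makes the bound hold everywhere. By the hypothesis on
    \<open>W0T\<close> it alters the planar function only on a null set.\<close>
  define G where "G s = (if cmod (g s) \<le> M * space_weight T s then g s else 0)" for s
  have G_measurable [measurable]: "G \<in> borel_measurable borel" unfolding G_def by measurable
  have M: "0 \<le> M" using \<open>L > 0\<close> by (simp add: M_def)
  have G_le: "cmod (G s) \<le> M * space_weight T s" for s
    using M by (simp add: G_def space_weight_nonneg)
  have W0T_G: "AE x in lborel. W0T x = G ((norm x)\<^sup>2)"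
  proof -
    have "AE x in lborel. x \<noteq> (0 :: real \<times> real)" by (rule AE_lborel_singleton)
    moreover have "AE x in lborel. x \<noteq> 0 \<longrightarrow>
        cmod (W0T x) \<le> L / (2 * pi) * exp (- (norm x)\<^sup>2 / (4 * T)) * ln (1 + 4 * T / (norm x)\<^sup>2)"
      using bound by (simp add: AE_completion_iff)
    ultimately show ?thesis using g
    proof eventually_elim
      case (elim x)
      have "0 < (norm x)\<^sup>2" using elim(1) by simp
      from target_bound_le_space_weight[OF \<open>T > 0\<close> \<open>L > 0\<close> this] elim
      have "cmod (W0T x) \<le> M * space_weight T ((norm x)\<^sup>2)" by (simp add: M_def)
      then show ?case using elim(3) by (simp add: G_def)
    qed
  qed
  have "\<forall>N. \<exists>w. w \<in> borel_measurable borel \<and> (\<forall>\<xi>. cmod (w \<xi>) \<le> L) \<and>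
      (\<forall>n\<le>N. (LINT \<xi>:{0<..<T}|lborel. \<xi> ^ n *\<^sub>R w \<xi>) = \<omega> n)"
  proof
    fix N
    obtain u where u: "u \<in> Linf_space T" "Linf_norm T u \<le> ereal L"
      and u_moments: "\<And>n. n \<le> N \<Longrightarrow> (LINT \<xi>:{0<..<T}|lebesgue. \<xi> ^ n *\<^sub>R u (T - \<xi>)) = \<omega> n"
      using moments[of N] by blast
    obtain w where [measurable]: "w \<in> borel_measurable borel" and w: "\<And>\<xi>. cmod (w \<xi>) \<le> L"
      and uw: "AE \<xi> in lborel. 0 < \<xi> \<and> \<xi> < T \<longrightarrow> u (T - \<xi>) = w \<xi>"
      using control_representative[OF \<open>L > 0\<close> u] by blast
    have "(LINT \<xi>:{0<..<T}|lebesgue. \<xi> ^ n *\<^sub>R u (T - \<xi>)) = (LINT \<xi>:{0<..<T}|lborel. \<xi> ^ n *\<^sub>R w \<xi>)" for n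
      unfolding set_lebesgue_integral_def
    proof (rule integral_lebesgue_AE)
      show "AE \<xi> in lborel. indicator {0<..<T} \<xi> *\<^sub>R (\<xi> ^ n *\<^sub>R u (T - \<xi>)) =
          indicator {0<..<T} \<xi> *\<^sub>R (\<xi> ^ n *\<^sub>R w \<xi>)"
        using uw by eventually_elim (auto simp: indicator_def)
    qed measurable
    then show "\<exists>w. w \<in> borel_measurable borel \<and> (\<forall>\<xi>. cmod (w \<xi>) \<le> L) \<and>
        (\<forall>n\<le>N. (LINT \<xi>:{0<..<T}|lborel. \<xi> ^ n *\<^sub>R w \<xi>) = \<omega> n)"
      using u_moments w by (intro exI[of _ w]) simp
  qed
  from choice[OF this] obtain w where w_measurable [measurable]: "\<And>N. w N \<in> borel_measurable borel"
    and w: "\<And>N \<xi>. cmod (w N \<xi>) \<le> L"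
    and w_moments: "\<And>N n. n \<le> N \<Longrightarrow> (LINT \<xi>:{0<..<T}|lborel. \<xi> ^ n *\<^sub>R w N \<xi>) = \<omega> n"
    by blast
  let ?H = "\<lambda>N. control_profile T (w N)"
  have H_le: "cmod (?H N s) \<le> L * integral\<^sup>L lborel (time_weight T) * space_weight T s" for N s
    by (rule cmod_control_profile_le[OF w_measurable w])
  have "(LINT s:{0<..}|lborel. s ^ n *\<^sub>R G s) = (LINT s:{0<..}|lborel. s ^ n *\<^sub>R ?H N s)" if "n \<le> N" for n N
  proof -
    \<comment> \<open>\<open>?c\<close> is the multiple from \<open>quadrant_moment\<close>,
      \<open>?b\<close> the normalisation of \<open>\<omega>\<close>, and \<open>?a\<close> the
      factor from \<open>control_profile_moment\<close>. Their product is 1, so prescribing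
      \<open>\<omega> n\<close> for the control is the same as matching the \<open>n\<close>-th
      moments of \<open>G\<close> and of the profile.\<close>
    let ?a = "- (2 / pi * 4 ^ n * fact n) :: real"
      and ?b = "- 2 * (fact n / fact (2 * n)) :: real"
      and ?c = "pi / 4 * (fact (2 * n) / (4 ^ n * (fact n)\<^sup>2)) :: real"
    have \<omega>: "\<omega> n = ?b *\<^sub>R (?c *\<^sub>R (LINT s:{0<..}|lborel. s ^ n *\<^sub>R G s))"
      unfolding omega_eq
      by (subst lebesgue_quadrant_moment[OF G_measurable set_integrable_power_space_weight[OF G_measurable \<open>T > 0\<close> G_le] W0T_G])
         (rule refl)
    have "?a * (?b * ?c) = 1"
      by (simp add: power2_eq_square)
    then have "?a *\<^sub>R \<omega> n = (LINT s:{0<..}|lborel. s ^ n *\<^sub>R G s)"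
      unfolding \<omega> scaleR_scaleR by (simp only: scaleR_one)
    then show ?thesis
      using control_profile_moment[OF \<open>T > 0\<close> w_measurable w, of n N] w_moments[OF that] by simp
  qed
  then have lim: "(\<lambda>N. LINT s:{0<..}|lborel. (cmod (G s - ?H N s))\<^sup>2) \<longlonglongrightarrow> 0"
    by (intro moment_convergence[OF \<open>T > 0\<close> _ _ G_le w]) auto
  \<comment> \<open>This state is the target with the profile \<open>G\<close> exchanged for that of
    the control. Starting from \<open>WT\<close> makes membership in \<open>Hhat0\<close> follow
    from that of \<open>WT\<close> and from the radial correction; almost everywhere it equals the
    free state plus the control state.\<close>
  define V where "V N x = WT x + (?H N ((norm x)\<^sup>2) - G ((norm x)\<^sup>2))" for N x
  have diff_L2: "(\<lambda>x :: real \<times> real. ?H N ((norm x)\<^sup>2) - G ((norm x)\<^sup>2)) \<in> L2_space UNIV" for N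
  proof (rule radial_L2_space[of "\<lambda>s. ?H N s - G s", OF _ \<open>T > 0\<close>])
    show "cmod (?H N s - G s) \<le> (L * integral\<^sup>L lborel (time_weight T) + M) * space_weight T s" for s
      using norm_triangle_ineq4[of "?H N s" "G s"] H_le[of N s] G_le[of s] by (simp add: distrib_right)
  qed measurable
  have V_Hhat0: "V N \<in> Hhat0" for N
  proof -
    have "V N \<in> L2_space UNIV"
      unfolding V_def using \<open>WT \<in> Hhat0\<close> by (intro L2_space_add diff_L2) (simp add: Hhat0_def)
    moreover have "AE x in lebesgue. V N (- fst x, snd x) = V N x"
      using \<open>WT \<in> Hhat0\<close> by (auto simp: Hhat0_def V_def norm_prod_power2 elim: eventually_mono)
    ultimately show ?thesis by (simp add: Hhat0_def)
  qed
  have V_reachable: "V N \<in> reachable_set L T W0" for N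
  proof -
    have "AE x in lborel. x \<noteq> (0 :: real \<times> real)" by (rule AE_lborel_singleton)
    then have "AE x in lborel. V N x = free_state W0 T x + control_state (\<lambda>t. w N (T - t)) T x"
      using W0T_G
    proof eventually_elim
      case (elim x)
      have "control_state (\<lambda>t. w N (T - t)) T x = ?H N ((norm x)\<^sup>2)"
        by (rule reflected_control(3)[OF w_measurable w elim(1)])
      then show ?case using elim(2)
        by (simp add: V_def W0T_eq algebra_simps)
    qed
    then have "AE x in lebesgue. V N x = free_state W0 T x + control_state (\<lambda>t. w N (T - t)) T x"
      by (rule AE_completion)
    moreover have "(\<lambda>t. w N (T - t)) \<in> Linf_space T" "Linf_norm T (\<lambda>t. w N (T - t)) \<le> ereal L"
      by (rule reflected_control[OF w_measurable w])+
    ultimately show ?thesis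
      using V_Hhat0[of N] unfolding reachable_set_def by blast
  qed
  have V_lim: "(\<lambda>N. L2_norm (\<lambda>x. V N x - WT x)) \<longlonglongrightarrow> 0"
  proof -
    obtain c where c: "\<And>F. F \<in> borel_measurable borel \<Longrightarrow>
        L2_norm (\<lambda>x. F ((norm x)\<^sup>2)) = sqrt (c * (LINT s:{0<..}|lborel. (cmod (F s))\<^sup>2))"
      using L2_norm_radial by blast
    have "L2_norm (\<lambda>x. V N x - WT x) = sqrt (c * (LINT s:{0<..}|lborel. (cmod (G s - ?H N s))\<^sup>2))" for N
      using c[of "\<lambda>s. ?H N s - G s"] by (simp add: V_def norm_minus_commute)
    moreover have "(\<lambda>N. sqrt (c * (LINT s:{0<..}|lborel. (cmod (G s - ?H N s))\<^sup>2))) \<longlonglongrightarrow> sqrt (c * 0)"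
      by (intro tendsto_intros lim)
    ultimately show ?thesis by simp
  qed
  show ?thesis
    unfolding in_closure_of topspace_Hhat0_topology
  proof (intro conjI allI impI)
    fix U assume "WT \<in> U \<and> openin Hhat0_topology U"
    then obtain \<epsilon> where \<epsilon>: "0 < \<epsilon>" "\<And>f. f \<in> Hhat0 \<Longrightarrow> L2_norm (\<lambda>x. f x - WT x) < \<epsilon> \<Longrightarrow> f \<in> U"
      unfolding openin_Hhat0_topology by blast
    obtain N where "L2_norm (\<lambda>x. V N x - WT x) < \<epsilon>"
      using order_tendstoD(2)[OF V_lim \<epsilon>(1)] by (auto simp: eventually_sequentially)
    then show "\<exists>y. y \<in> reachable_set L T W0 \<and> y \<in> U"
      using \<epsilon>(2) V_Hhat0 V_reachable by blast
  qed fact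
qed

end
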